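(* Let $X$ be an $n\times n$ symmetric matrix of indeterminates over $\mathbb{Z}$, $S=\mathbb{Z}[X]$ and $R=S/(\det X)$. \begin{enumerate} \item[(a)] If $n=3$ and $p$ is an odd prime, then the Frobenius endomorphism of $R/pR$ lifts to an endomorphism of $R/p^2R$. \item[(b)] If $n\geqslant3$, then the Frobenius endomorphism of $R/2R$ does not lift to an endomorphism of $R/4R$. \item[(c)] If $n\geqslant4$ and $p$ is an odd prime, then the Frobenius endomorphism of $R/pR$ does not lift to an endomorphism of $R/p^2R$. \end{enumerate}
   Context: A lift of the Frobenius endomorphism of $R/pR$ to $R/p^2R$ is a ring endomorphism $\Lambda$ of $R/p^2R$ with $\Lambda(r)\equiv r^p\pmod p$ for all $r\in R/p^2R$. *)

theory Defs
  imports "HOL-Library.Poly_Mapping" "HOL-Computational_Algebra.Primes"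
    "HOL-Algebra.QuotRing" "Jordan_Normal_Form.Determinant"
begin

text \<open>The integral polynomial ring in the indeterminates x_(i,j), indexed by pairs (i,j)
  with i \<le> j < n (the independent entries of a symmetric n x n matrix).
  Polynomials are finitely supported maps from monomials (finitely supported exponent
  vectors) to integer coefficients.\<close>

type_synonym zpoly = "((nat \<times> nat) \<Rightarrow>\<^sub>0 nat) \<Rightarrow>\<^sub>0 int"

definition sym_vars :: "nat \<Rightarrow> (nat \<times> nat) set" where
  "sym_vars n = {(i, j). i \<le> j \<and> j < n}"

definition Xvar :: "nat \<times> nat \<Rightarrow> zpoly" where
  "Xvar v = Poly_Mapping.single (Poly_Mapping.single v 1) 1"

definition S_ring :: "nat \<Rightarrow> zpoly ring" where
  "S_ring n = \<lparr>carrier = {f. \<forall>m \<in> Poly_Mapping.keys f. Poly_Mapping.keys m \<subseteq> sym_vars n},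
              monoid.mult = (*), monoid.one = 1, ring.zero = 0, ring.add = (+)\<rparr>"

definition symX :: "nat \<Rightarrow> zpoly mat" where
  "symX n = mat n n (\<lambda>(i, j). Xvar (min i j, max i j))"

definition R_ring :: "nat \<Rightarrow> zpoly set ring" where
  "R_ring n = S_ring n Quot (genideal (S_ring n) {det (symX n)})"

definition mod_nat :: "('a, 'b) ring_scheme \<Rightarrow> nat \<Rightarrow> 'a set ring" where
  "mod_nat A m = A Quot (genideal A {[m] \<cdot>\<^bsub>A\<^esub> \<one>\<^bsub>A\<^esub>})"

text \<open>A lift of the Frobenius of A/pA to A (where A is to be taken as R/p^2R):
  a ring endomorphism L of A with L r congruent to r^p modulo p, i.e.
  L r - r^p lies in pA.\<close>
definition lifts_frobenius :: "('a, 'b) ring_scheme \<Rightarrow> nat \<Rightarrow> bool" where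
  "lifts_frobenius A p \<longleftrightarrow>
     (\<exists>L. L \<in> Ring.ring_hom A A \<and>
        (\<forall>r \<in> carrier A. \<exists>t \<in> carrier A.
            L r = r [^]\<^bsub>A\<^esub> p \<oplus>\<^bsub>A\<^esub> (([p] \<cdot>\<^bsub>A\<^esub> \<one>\<^bsub>A\<^esub>) \<otimes>\<^bsub>A\<^esub> t)))"

end

theory Submission
  imports "HOL-Algebra.Algebraic_Closure_Type" "HOL-Computational_Algebra.Polynomial_Factorial"
    "HOL-Library.Product_Lexorder" Defs
begin

text \<open>
  A lift sends the indeterminate x_ij to y_ij = x_ij^p + p g_ij for some polynomials g_ij, and such a
  substitution descends to R/p^2R iff det (y_ij) lies in the ideal (det X, p^2).

  Non-existence. Specialise X to the block matrix diag(\<xi>, 1) with \<xi> a k x k symmetric matrix of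
  determinant 0, scaled by weights: x_ij = w_i w_j \<xi>_ij. Modulo p^2 the condition becomes
  p^2 dvd det (x_ij^p + p g_ij) for the k x k corner. Compare coefficients of (w_1 ... w_k)^(2p): by
  homogeneity g_ij can contribute only an integer multiple of \<xi>_ij^p. For p = 2 and k = 3 a
  matrix of integers with even diagonal and odd off-diagonal entries gives 1 = 0 modulo 2. For p odd and
  k = 4 take zero diagonal and off-diagonal entries s, 1, s + 1, each twice; the determinant
  of (\<xi>_ij^p) is then divisible by a + b - c where a = s^p, b = 1, c = (s + 1)^p, so that
  \<psi> = ((s + 1)^p - s^p - 1)/p would be, modulo p, a linear combination of s^p and 1, which it is not.

  Existence for n = 3. A symmetric matrix of rank 2 is u v^T + v u^T, and the toric lift
  u_i -> u_i^p, v_i -> v_i^p maps 2 u_i v_i to 2 (u_i v_i)^p and u_i v_j + u_j v_i to the Dickson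
  polynomial D_p(x_ij, x_ii x_jj / 4); these formulas make sense over S modulo p^2 since 2 is invertible.
\<close>

section \<open>Evaluation of integral polynomials\<close>

definition monom_val :: "('v \<Rightarrow> 'a::comm_ring_1) \<Rightarrow> ('v \<Rightarrow>\<^sub>0 nat) \<Rightarrow> 'a" where
  "monom_val x m = (\<Prod>v\<in>Poly_Mapping.keys m. x v ^ Poly_Mapping.lookup m v)"

definition poly_val :: "('v \<Rightarrow> 'a::comm_ring_1) \<Rightarrow> (('v \<Rightarrow>\<^sub>0 nat) \<Rightarrow>\<^sub>0 int) \<Rightarrow> 'a" where
  "poly_val x f = (\<Sum>m\<in>Poly_Mapping.keys f. of_int (Poly_Mapping.lookup f m) * monom_val x m)"

lemma monom_val_superset:
  assumes "finite V" "Poly_Mapping.keys m \<subseteq> V"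
  shows "monom_val x m = (\<Prod>v\<in>V. x v ^ Poly_Mapping.lookup m v)"
  unfolding monom_val_def using assms
  by (intro prod.mono_neutral_left) (auto simp: in_keys_iff)

lemma monom_val_add: "monom_val x (m + m') = monom_val x m * monom_val x m'"
proof -
  let ?V = "Poly_Mapping.keys m \<union> Poly_Mapping.keys m'"
  have "Poly_Mapping.keys (m + m') \<subseteq> ?V" by (rule keys_add)
  then show ?thesis
    by (simp add: monom_val_superset[of ?V] lookup_add power_add prod.distrib)
qed

lemma monom_val_0 [simp]: "monom_val x 0 = 1"
  by (simp add: monom_val_def)

lemma monom_val_single [simp]: "monom_val x (Poly_Mapping.single v k) = x v ^ k"
  by (simp add: monom_val_def)

lemma poly_val_0 [simp]: "poly_val x 0 = 0"
  by (simp add: poly_val_def)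

lemma poly_val_add: "poly_val x (f + g) = poly_val x f + poly_val x g"
  unfolding poly_val_def
  by (rule setsum_keys_plus_distrib) (simp_all add: algebra_simps)

lemma poly_val_single [simp]:
  "poly_val x (Poly_Mapping.single m c) = of_int c * monom_val x m"
  by (simp add: poly_val_def)

lemma poly_mapping_sum_induct [case_names zero add]:
  assumes "P 0" "\<And>m c f. m \<notin> Poly_Mapping.keys f \<Longrightarrow> c \<noteq> 0 \<Longrightarrow> P f \<Longrightarrow>
    P (Poly_Mapping.single m c + f)"
  shows "P (f :: 'k \<Rightarrow>\<^sub>0 'c::comm_monoid_add)"
proof (induction f rule: update_induct)
  case (update f m c)
  have "Poly_Mapping.update m c f = Poly_Mapping.single m c + f"
    using update(1)
    by (intro poly_mapping_eqI) (auto simp: lookup_update lookup_add lookup_single when_def in_keys_iff)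
  then show ?case using assms(2) update by simp
qed (rule assms(1))

lemma poly_val_mult: "poly_val x (f * g) = poly_val x f * poly_val x g"
proof (induction f rule: poly_mapping_sum_induct)
  case (add m c f)
  have "poly_val x (Poly_Mapping.single m c * g) = poly_val x (Poly_Mapping.single m c) * poly_val x g"
    by (induction g rule: poly_mapping_sum_induct)
      (simp_all add: distrib_left poly_val_add mult_single monom_val_add algebra_simps)
  with add show ?case by (simp add: distrib_right poly_val_add)
qed simp

lemma poly_val_1 [simp]: "poly_val x 1 = 1"
  using poly_val_single[of x 0 1] by (simp add: single_one)

interpretation poly_val: comm_ring_hom "poly_val x"
  by standard (simp_all add: poly_val_add poly_val_mult)

lemma poly_val_Xvar [simp]: "poly_val x (Xvar v) = x v"
  by (simp add: Xvar_def)

section \<open>Polynomials in a prescribed set of variables\<close>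

definition polys_in :: "(nat \<times> nat) set \<Rightarrow> zpoly set" where
  "polys_in V = {f. \<forall>m\<in>Poly_Mapping.keys f. Poly_Mapping.keys m \<subseteq> V}"

lemma polys_in_add: "f \<in> polys_in V \<Longrightarrow> g \<in> polys_in V \<Longrightarrow> f + g \<in> polys_in V"
  using keys_add[of f g] by (auto simp: polys_in_def)

lemma polys_in_mult: "f \<in> polys_in V \<Longrightarrow> g \<in> polys_in V \<Longrightarrow> f * g \<in> polys_in V"
proof -
  assume fg: "f \<in> polys_in V" "g \<in> polys_in V"
  have "Poly_Mapping.keys m \<subseteq> V" if m: "m \<in> Poly_Mapping.keys (f * g)" for m
  proof -
    obtain a b where "m = a + b" "a \<in> Poly_Mapping.keys f" "b \<in> Poly_Mapping.keys g"
      using keys_mult[of f g] m by blast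
    then show ?thesis using fg keys_add[of a b] unfolding polys_in_def by blast
  qed
  then show ?thesis by (simp add: polys_in_def)
qed

lemma polys_in_uminus: "f \<in> polys_in V \<Longrightarrow> - f \<in> polys_in V"
  by (auto simp: polys_in_def)

lemma polys_in_of_int [simp]: "of_int c \<in> polys_in V"
  by (auto simp: polys_in_def simp flip: single_of_int split: if_splits)

lemma polys_in_0 [simp]: "0 \<in> polys_in V"
  using polys_in_of_int[of 0] by simp

lemma polys_in_1 [simp]: "1 \<in> polys_in V"
  using polys_in_of_int[of 1] by simp

lemma polys_in_of_nat [simp]: "of_nat c \<in> polys_in V"
  using polys_in_of_int[of "int c"] by simp

lemma polys_in_Xvar [simp]: "v \<in> V \<Longrightarrow> Xvar v \<in> polys_in V"
  by (auto simp: polys_in_def Xvar_def)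

lemma polys_in_power: "f \<in> polys_in V \<Longrightarrow> f ^ k \<in> polys_in V"
  by (induction k) (auto intro: polys_in_mult)

lemma polys_in_sum: "(\<And>i. i \<in> I \<Longrightarrow> f i \<in> polys_in V) \<Longrightarrow> sum f I \<in> polys_in V"
  by (induction I rule: infinite_finite_induct) (auto intro: polys_in_add)

lemma polys_in_prod: "(\<And>i. i \<in> I \<Longrightarrow> f i \<in> polys_in V) \<Longrightarrow> prod f I \<in> polys_in V"
  by (induction I rule: infinite_finite_induct) (auto intro: polys_in_mult)

lemma single_eq_monom_val:
  "Poly_Mapping.single m c = of_int c * monom_val Xvar m" for m :: "(nat \<times> nat) \<Rightarrow>\<^sub>0 nat"
proof -
  have pow: "Xvar v ^ k = Poly_Mapping.single (Poly_Mapping.single v k) 1" for v k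
    by (induction k) (simp_all add: Xvar_def mult_single single_one flip: single_add)
  have "Poly_Mapping.single m (1::int) = monom_val Xvar m"
  proof (induction m rule: poly_mapping_sum_induct)
    case (add v k m)
    have "Poly_Mapping.single (Poly_Mapping.single v k + m) (1::int) =
        Poly_Mapping.single (Poly_Mapping.single v k) 1 * Poly_Mapping.single m 1"
      by (simp add: mult_single)
    then show ?case using add by (simp add: monom_val_add pow)
  qed (simp add: single_one)
  moreover have "of_int c = Poly_Mapping.single (0 :: (nat \<times> nat) \<Rightarrow>\<^sub>0 nat) c"
    by (metis of_int_eq_id id_apply single_of_int)
  ultimately have "of_int c * monom_val Xvar m = Poly_Mapping.single 0 c * Poly_Mapping.single m 1"
    by simp
  then show ?thesis by (simp only: mult_single) simp
qed

text \<open>The subring is generated by the integers and its variables. Membership of the operands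
  is kept in the sum and product cases because the homomorphism laws on \<open>S_ring n\<close>
  apply only inside the carrier.\<close>

lemma polys_in_induct [consumes 1, case_names of_int var add mult]:
  assumes f: "f \<in> polys_in V"
    and of_int: "\<And>c. P (of_int c)" and var: "\<And>v. v \<in> V \<Longrightarrow> P (Xvar v)"
    and add: "\<And>f g. f \<in> polys_in V \<Longrightarrow> g \<in> polys_in V \<Longrightarrow> P f \<Longrightarrow> P g \<Longrightarrow> P (f + g)"
    and mult: "\<And>f g. f \<in> polys_in V \<Longrightarrow> g \<in> polys_in V \<Longrightarrow> P f \<Longrightarrow> P g \<Longrightarrow> P (f * g)"
  shows "P f"
proof -
  have pow: "P (Xvar v ^ k)" if "v \<in> V" for v k
    using that of_int[of 1] by (induction k) (auto intro!: mult var polys_in_power polys_in_Xvar)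
  have prod: "P (\<Prod>v\<in>I. Xvar v ^ k v)" if "I \<subseteq> V" "finite I" for I k
    using that(2,1) of_int[of 1]
    by (induction I) (auto intro!: mult pow polys_in_power polys_in_prod)
  have "P f \<and> f \<in> polys_in V" using f
  proof (induction f rule: poly_mapping_sum_induct)
    case zero
    show ?case using of_int[of 0] by simp
  next
    case (add m c f)
    have "Poly_Mapping.keys (Poly_Mapping.single m c + f) = insert m (Poly_Mapping.keys f)"
      using add.hyps by (auto simp: in_keys_iff lookup_add lookup_single when_def split: if_splits)
    then have m: "Poly_Mapping.keys m \<subseteq> V" and f: "f \<in> polys_in V"
      using add.prems by (auto simp: polys_in_def)
    have "monom_val Xvar m \<in> polys_in V" "P (monom_val Xvar m)"
      using m by (auto simp: monom_val_def intro!: polys_in_prod polys_in_power prod)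
    then have "P (Poly_Mapping.single m c)" "Poly_Mapping.single m c \<in> polys_in V"
      by (auto simp: single_eq_monom_val intro!: mult of_int polys_in_mult)
    then show ?case using add.IH f assms(4) polys_in_add by blast
  qed
  then show ?thesis ..
qed

lemma polys_in_UNIV [simp]: "polys_in UNIV = UNIV"
  by (simp add: polys_in_def)

lemma poly_val_in_polys_in:
  assumes "\<And>v. x v \<in> polys_in V"
  shows "poly_val x f \<in> polys_in V"
  unfolding poly_val_def monom_val_def
  by (intro polys_in_sum polys_in_mult polys_in_of_int polys_in_prod polys_in_power assms)

lemma poly_val_cong:
  assumes "f \<in> polys_in V" "\<And>v. v \<in> V \<Longrightarrow> x v = y v"
  shows "poly_val x f = poly_val y f"
  using assms(1)
  by (induction rule: polys_in_induct)
    (simp_all add: poly_val.hom_add poly_val.hom_mult poly_val.hom_of_int assms(2))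

lemma poly_val_Xvar_id: "poly_val Xvar f = f"
  by (induction f rule: poly_mapping_sum_induct) (simp_all add: poly_val_add flip: single_eq_monom_val)

section \<open>Setting variables to zero\<close>

definition restrict_vars :: "(nat \<times> nat) set \<Rightarrow> zpoly \<Rightarrow> zpoly" where
  "restrict_vars V = poly_val (\<lambda>v. if v \<in> V then Xvar v else 0)"

interpretation restrict_vars: comm_ring_hom "restrict_vars V"
  unfolding restrict_vars_def by (rule poly_val.comm_ring_hom_axioms)

lemma restrict_vars_in [simp]: "restrict_vars V f \<in> polys_in V"
  unfolding restrict_vars_def by (rule poly_val_in_polys_in) simp

lemma restrict_vars_id: "f \<in> polys_in V \<Longrightarrow> restrict_vars V f = f"
  unfolding restrict_vars_def
  by (subst poly_val_cong[where y = Xvar and V = V]) (simp_all add: poly_val_Xvar_id)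

text \<open>\<open>restrict_vars (- {v})\<close> sets the variable \<open>v\<close> to zero, so this
  is the factor theorem at zero: \<open>f\<close> and its restriction always differ by a multiple of
  \<open>Xvar v\<close>.\<close>

lemma Xvar_dvd_iff: "Xvar v dvd f \<longleftrightarrow> restrict_vars (- {v}) f = 0"
proof
  assume "Xvar v dvd f"
  then obtain g where "f = Xvar v * g" ..
  then show "restrict_vars (- {v}) f = 0"
    by (simp add: restrict_vars.hom_mult) (simp add: restrict_vars_def)
next
  have "f \<in> polys_in UNIV" by simp
  then have "Xvar v dvd f - restrict_vars (- {v}) f"
  proof (induction rule: polys_in_induct)
    case (add f g)
    then show ?case
      using dvd_add[of "Xvar v"] by (fastforce simp: restrict_vars.hom_add algebra_simps)
  next
    case (mult f g)
    have "f * g - restrict_vars (- {v}) (f * g) =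
        (f - restrict_vars (- {v}) f) * g + restrict_vars (- {v}) f * (g - restrict_vars (- {v}) g)"
      by (simp add: restrict_vars.hom_mult algebra_simps)
    then show ?case using mult by simp
  qed (auto simp: restrict_vars_def poly_val.hom_of_int)
  then show "Xvar v dvd f" if "restrict_vars (- {v}) f = 0"
    using that by simp
qed

text \<open>A variable is a prime element, since setting it to zero lands in an integral domain; it
  is cancelled from \<open>c\<close> one power at a time.\<close>

lemma Xvar_power_dvd_mult_left:
  assumes "Xvar v ^ k * a = b * c" "\<not> Xvar v dvd b"
  shows "b dvd a"
  using assms
proof (induction k arbitrary: c)
  case (Suc k)
  have "poly_val (\<lambda>_. 1) (Xvar v) \<noteq> (0::int)" by simp
  then have X0: "Xvar v \<noteq> 0" by (metis poly_val_0)
  have "Xvar v dvd b * c" using Suc.prems(1) by (metis dvd_triv_left mult.assoc power_Suc)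
  then have "Xvar v dvd c"
    using Suc.prems(2) by (simp add: Xvar_dvd_iff restrict_vars.hom_mult)
  then obtain d where "c = Xvar v * d" ..
  with Suc.prems X0 have "Xvar v ^ k * a = b * d" by (simp add: algebra_simps)
  with Suc show ?case by blast
qed simp

section \<open>The ring R/mR as a quotient of the polynomial ring\<close>

lemma S_ring_simps [simp]:
  "carrier (S_ring n) = polys_in (sym_vars n)"
  "x \<otimes>\<^bsub>S_ring n\<^esub> y = x * y" "x \<oplus>\<^bsub>S_ring n\<^esub> y = x + y"
  "\<one>\<^bsub>S_ring n\<^esub> = 1" "\<zero>\<^bsub>S_ring n\<^esub> = 0"
  by (auto simp: S_ring_def polys_in_def)

lemma cring_S_ring: "cring (S_ring n)"
proof (rule cringI)
  show "abelian_group (S_ring n)"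
    by (rule abelian_groupI)
      (auto intro: polys_in_add simp: algebra_simps intro!: bexI[of _ "- _"] polys_in_uminus)
  show "Group.comm_monoid (S_ring n)"
    by (rule comm_monoidI) (auto intro: polys_in_mult simp: algebra_simps)
qed (simp add: algebra_simps)

text \<open>Used twice: for the polynomial ring modulo the determinant, and then for that quotient
  modulo an integer.\<close>

lemma (in cring) principal_quotient:
  assumes "a \<in> carrier R"
  defines "I \<equiv> genideal R {a}"
  shows "cring (R Quot I)" "(+>) I \<in> Ring.ring_hom R (R Quot I)"
    "carrier (R Quot I) = (+>) I ` carrier R"
    "\<And>x. x \<in> carrier R \<Longrightarrow> I +> x = \<zero>\<^bsub>R Quot I\<^esub> \<longleftrightarrow> (\<exists>y\<in>carrier R. x = y \<otimes> a)"
proof -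
  interpret I: ideal I R
    unfolding I_def using assms(1) by (intro genideal_ideal) simp
  show "cring (R Quot I)" by (rule I.quotient_is_cring[OF is_cring])
  show "(+>) I \<in> Ring.ring_hom R (R Quot I)" by (rule I.rcos_ring_hom)
  show "carrier (R Quot I) = (+>) I ` carrier R"
    by (auto simp: FactRing_def A_RCOSETS_def')
  have "x \<in> I \<longleftrightarrow> (\<exists>y\<in>carrier R. x = y \<otimes> a)" for x
    unfolding I_def cgenideal_eq_genideal[OF assms(1), symmetric] by (auto simp: cgenideal_def)
  moreover have "I +> x = I \<longleftrightarrow> x \<in> I" if "x \<in> carrier R" for x
    using I.rcos_const_imp_mem[OF that] I.a_rcos_const by blast
  moreover have "\<zero>\<^bsub>R Quot I\<^esub> = I" by (simp add: FactRing_def)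
  ultimately show "I +> x = \<zero>\<^bsub>R Quot I\<^esub> \<longleftrightarrow> (\<exists>y\<in>carrier R. x = y \<otimes> a)"
    if "x \<in> carrier R" for x
    using that by simp
qed

lemma map_mat_symX: "map_mat (poly_val x) (symX n) = mat n n (\<lambda>(i, j). x (min i j, max i j))"
  by (rule eq_matI) (auto simp: symX_def)

lemma poly_val_det_symX: "poly_val x (det (symX n)) = det (mat n n (\<lambda>(i, j). x (min i j, max i j)))"
  by (simp add: map_mat_symX flip: poly_val.hom_det)

lemma det_symX_in [simp]: "det (symX n) \<in> polys_in (sym_vars n)"
proof -
  have "map_mat (restrict_vars (sym_vars n)) (symX n) = symX n"
    by (rule eq_matI) (auto simp: symX_def restrict_vars_id sym_vars_def)
  then have "det (symX n) = restrict_vars (sym_vars n) (det (symX n))"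
    by (metis restrict_vars.hom_det)
  then show ?thesis by (metis restrict_vars_in)
qed

definition proj :: "nat \<Rightarrow> nat \<Rightarrow> zpoly \<Rightarrow> zpoly set set" where
  "proj n m f = genideal (R_ring n) {[m] \<cdot>\<^bsub>R_ring n\<^esub> \<one>\<^bsub>R_ring n\<^esub>} +>\<^bsub>R_ring n\<^esub>
     (genideal (S_ring n) {det (symX n)} +>\<^bsub>S_ring n\<^esub> f)"

lemma ring_hom_of_nat:
  assumes "h \<in> Ring.ring_hom (S_ring n) A" "cring A"
  shows "h (of_nat k) = [k] \<cdot>\<^bsub>A\<^esub> \<one>\<^bsub>A\<^esub>"
proof -
  interpret A: cring A by fact
  interpret S: cring "S_ring n" by (rule cring_S_ring)
  interpret h: ring_hom_cring "S_ring n" A h using assms(1) by unfold_locales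
  show ?thesis
  proof (induction k)
    case 0
    then show ?case using h.hom_zero by simp
  next
    case (Suc k)
    then show ?case
      using ring_hom_add[OF assms(1), of "of_nat k" 1] h.hom_one
      by (simp add: A.a_comm add.commute)
  qed
qed

text \<open>The variables generate the ring over the integers, whose images are forced: naturals
  through one, negatives through additive inverses.\<close>

lemma ring_hom_S_ring_eqI:
  assumes h: "h \<in> Ring.ring_hom (S_ring n) A" and h': "h' \<in> Ring.ring_hom (S_ring n) A"
    and "cring A" and var: "\<And>v. v \<in> sym_vars n \<Longrightarrow> h (Xvar v) = h' (Xvar v)"
    and f: "f \<in> polys_in (sym_vars n)"
  shows "h f = h' f"
proof -
  interpret A: cring A by fact
  interpret S: cring "S_ring n" by (rule cring_S_ring)
  interpret h: ring_hom_cring "S_ring n" A h using h by unfold_locales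
  interpret h': ring_hom_cring "S_ring n" A h' using h' by unfold_locales
  have nat: "h (of_nat k) = h' (of_nat k)" for k
    by (simp only: ring_hom_of_nat[OF h assms(3)] ring_hom_of_nat[OF h' assms(3)])
  have minus: "\<ominus>\<^bsub>S_ring n\<^esub> x = - x" if "x \<in> polys_in (sym_vars n)" for x
    using that by (intro S.minus_equality) (auto intro: polys_in_uminus)
  show ?thesis using f
  proof (induction rule: polys_in_induct)
    case (of_int c)
    show ?case
    proof (cases "c \<ge> 0")
      case True
      then show ?thesis using nat[of "nat c"] by simp
    next
      case False
      then have c: "of_int c = - (of_nat (nat (- c)) :: zpoly)" by simp
      show ?thesis
        unfolding c using nat[of "nat (- c)"] h.hom_a_inv[of "of_nat (nat (- c))"]
          h'.hom_a_inv[of "of_nat (nat (- c))"] minus[of "of_nat (nat (- c))"]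
        by simp
    qed
  next
    case (add f g)
    then show ?case using h.hom_add[of f g] h'.hom_add[of f g] by simp
  next
    case (mult f g)
    then show ?case using h.hom_mult[of f g] h'.hom_mult[of f g] by simp
  qed (rule var)
qed

text \<open>Identifies R/mR with the polynomial ring modulo \<open>det (symX n)\<close> and
  \<open>m\<close>. The witnesses in the kernel criterion range over all of \<open>zpoly\<close>,
  which spares later divisibility arguments any bookkeeping of variables.\<close>

lemma proj:
  shows cring_mod_nat: "cring (mod_nat (R_ring n) m)"
    and proj_hom: "proj n m \<in> Ring.ring_hom (S_ring n) (mod_nat (R_ring n) m)"
    and carrier_mod_nat: "carrier (mod_nat (R_ring n) m) = proj n m ` polys_in (sym_vars n)"
    and proj_eq_zero_iff: "f \<in> polys_in (sym_vars n) \<Longrightarrow>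
      proj n m f = \<zero>\<^bsub>mod_nat (R_ring n) m\<^esub> \<longleftrightarrow> (\<exists>h s. f = h * det (symX n) + of_nat m * s)"
proof -
  interpret S: cring "S_ring n" by (rule cring_S_ring)
  define I where "I = genideal (S_ring n) {det (symX n)}"
  define q where "q = (+>\<^bsub>S_ring n\<^esub>) I"
  have R_def: "R_ring n = S_ring n Quot I" by (simp add: R_ring_def I_def)
  note Q = S.principal_quotient[of "det (symX n)", folded I_def, folded R_def q_def, simplified]
  interpret R: cring "R_ring n" by (rule Q(1))
  define J where "J = genideal (R_ring n) {[m] \<cdot>\<^bsub>R_ring n\<^esub> \<one>\<^bsub>R_ring n\<^esub>}"
  define r where "r = (+>\<^bsub>R_ring n\<^esub>) J"
  have A_def: "mod_nat (R_ring n) m = R_ring n Quot J" by (simp add: mod_nat_def J_def)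
  note Q' = R.principal_quotient[of "[m] \<cdot>\<^bsub>R_ring n\<^esub> \<one>\<^bsub>R_ring n\<^esub>", folded J_def, folded A_def r_def, simplified]
  have proj_eq: "proj n m = r \<circ> q" by (auto simp: proj_def r_def q_def I_def J_def)
  show "cring (mod_nat (R_ring n) m)" by (rule Q'(1))
  show "proj n m \<in> Ring.ring_hom (S_ring n) (mod_nat (R_ring n) m)"
    unfolding proj_eq by (rule ring_hom_trans[OF Q(2) Q'(2)])
  show "carrier (mod_nat (R_ring n) m) = proj n m ` polys_in (sym_vars n)"
    by (simp add: proj_eq Q'(3) Q(3) image_comp)
  interpret q: ring_hom_cring "S_ring n" "R_ring n" q using Q(2) by unfold_locales
  let ?V = "sym_vars n"
  show "proj n m f = \<zero>\<^bsub>mod_nat (R_ring n) m\<^esub> \<longleftrightarrow> (\<exists>h s. f = h * det (symX n) + of_nat m * s)"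
    if f: "f \<in> polys_in ?V"
  proof -
    have nat: "q (of_nat m) = [m] \<cdot>\<^bsub>R_ring n\<^esub> \<one>\<^bsub>R_ring n\<^esub>"
      by (rule ring_hom_of_nat[OF Q(2) Q(1)])
    have minus: "a \<ominus>\<^bsub>S_ring n\<^esub> b = a - b" if "b \<in> polys_in ?V" for a b
      using that S.minus_equality[of "- b" b] by (simp add: a_minus_def polys_in_uminus)
    have qf: "q f \<in> carrier (R_ring n)" using f Q(3) by simp
    have "proj n m f = \<zero>\<^bsub>mod_nat (R_ring n) m\<^esub> \<longleftrightarrow>
        (\<exists>s\<in>polys_in ?V. q f = q s \<otimes>\<^bsub>R_ring n\<^esub> q (of_nat m))"
      unfolding nat using Q'(4)[OF qf] by (simp add: proj_eq Q(3))
    also have "\<dots> \<longleftrightarrow> (\<exists>s\<in>polys_in ?V. q (f - s * of_nat m) = \<zero>\<^bsub>R_ring n\<^esub>)"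
    proof (rule bex_cong[OF refl])
      fix s assume s: "s \<in> polys_in ?V"
      have sm: "s * of_nat m \<in> polys_in ?V" using s by (simp add: polys_in_mult)
      have "q (f - s * of_nat m) = q f \<ominus>\<^bsub>R_ring n\<^esub> q (s * of_nat m)"
        using minus[OF sm, of f] q.hom_add[of f "\<ominus>\<^bsub>S_ring n\<^esub> (s * of_nat m)"]
          q.hom_a_inv[of "s * of_nat m"] f sm S.a_inv_closed[of "s * of_nat m"]
        by (simp add: a_minus_def)
      moreover have "q (s * of_nat m) = q s \<otimes>\<^bsub>R_ring n\<^esub> q (of_nat m)"
        using q.hom_mult[of s "of_nat m"] s by simp
      moreover have "q (s * of_nat m) \<in> carrier (R_ring n)" using Q(3) sm by simp
      ultimately show "q f = q s \<otimes>\<^bsub>R_ring n\<^esub> q (of_nat m) \<longleftrightarrow> q (f - s * of_nat m) = \<zero>\<^bsub>R_ring n\<^esub>"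
        using R.r_right_minus_eq qf by simp
    qed
    also have "\<dots> \<longleftrightarrow> (\<exists>s\<in>polys_in ?V. \<exists>h\<in>polys_in ?V. f - s * of_nat m = h * det (symX n))"
      by (intro bex_cong refl Q(4)) (metis f diff_conv_add_uminus polys_in_add polys_in_mult polys_in_of_nat polys_in_uminus)
    also have "\<dots> \<longleftrightarrow> (\<exists>h s. f = h * det (symX n) + of_nat m * s)"
    proof
      assume "\<exists>h s. f = h * det (symX n) + of_nat m * s"
      then obtain h s where "f = h * det (symX n) + of_nat m * s" by blast
      \<comment> \<open>Killing the variables outside \<open>?V\<close> turns arbitrary witnesses
        into witnesses in the carrier; \<open>f\<close> and the determinant do not change.\<close>
      then have "restrict_vars ?V f = restrict_vars ?V (h * det (symX n) + of_nat m * s)" by simp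
      then have "f = restrict_vars ?V h * det (symX n) + of_nat m * restrict_vars ?V s"
        using f by (simp add: restrict_vars.hom_add restrict_vars.hom_mult restrict_vars_id)
      then show "\<exists>s\<in>polys_in ?V. \<exists>h\<in>polys_in ?V. f - s * of_nat m = h * det (symX n)"
        by (intro bexI[of _ "restrict_vars ?V s"] bexI[of _ "restrict_vars ?V h"])
          (simp_all add: algebra_simps)
    qed (auto simp: algebra_simps)
    finally show ?thesis .
  qed
qed

section \<open>Frobenius lifts and substitutions\<close>

lemma poly_val_ring_hom:
  assumes "\<And>v. v \<in> sym_vars n \<Longrightarrow> y v \<in> polys_in (sym_vars n)"
  shows "poly_val y \<in> Ring.ring_hom (S_ring n) (S_ring n)"
proof (rule ring_hom_memI)
  fix f assume f: "f \<in> carrier (S_ring n)"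
  then have "poly_val y f = poly_val (\<lambda>v. if v \<in> sym_vars n then y v else 0) f"
    by (intro poly_val_cong[where V = "sym_vars n"]) auto
  then show "poly_val y f \<in> carrier (S_ring n)"
    using assms by (simp add: poly_val_in_polys_in)
qed (simp_all add: poly_val.hom_add poly_val.hom_mult)

lemma proj_frobenius_form:
  fixes n m p :: nat
  assumes "f \<in> polys_in (sym_vars n)" "t \<in> polys_in (sym_vars n)"
  defines "A \<equiv> mod_nat (R_ring n) m"
  shows "proj n m f [^]\<^bsub>A\<^esub> p \<oplus>\<^bsub>A\<^esub> (([p] \<cdot>\<^bsub>A\<^esub> \<one>\<^bsub>A\<^esub>) \<otimes>\<^bsub>A\<^esub> proj n m t) =
    proj n m (f ^ p + of_nat p * t)"
proof -
  interpret A: cring A unfolding A_def by (rule cring_mod_nat)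
  interpret S: cring "S_ring n" by (rule cring_S_ring)
  interpret h: ring_hom_cring "S_ring n" A "proj n m"
    using proj_hom[of n m] unfolding A_def[symmetric] by unfold_locales
  have pow: "f [^]\<^bsub>S_ring n\<^esub> p = f ^ p"
    by (induction p) (simp_all add: nat_pow_def mult.commute)
  have "proj n m f [^]\<^bsub>A\<^esub> p = proj n m (f ^ p)"
    using ring_hom_ring.hom_nat_pow[OF ring_hom_ringI2[OF S.ring_axioms A.ring_axioms h.homh], of f p] assms(1) pow by simp
  moreover have "([p] \<cdot>\<^bsub>A\<^esub> \<one>\<^bsub>A\<^esub>) \<otimes>\<^bsub>A\<^esub> proj n m t = proj n m (of_nat p * t)"
    using h.hom_mult[of "of_nat p" t] assms(2) ring_hom_of_nat[OF h.homh A.is_cring, of p] by simp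
  ultimately show ?thesis
    using h.hom_add[of "f ^ p" "of_nat p * t"] assms(1,2) by (simp add: polys_in_power polys_in_mult)
qed

text \<open>Represent the images of the variables by polynomials. The lift and the resulting
  substitution give two homomorphisms into the quotient that agree on variables, hence on the
  determinant, which is zero there.\<close>

lemma lifts_frobenius_imp_det:
  assumes "lifts_frobenius (mod_nat (R_ring n) (p\<^sup>2)) p"
  obtains g h s where
    "poly_val (\<lambda>v. Xvar v ^ p + of_nat p * g v) (det (symX n)) = h * det (symX n) + of_nat (p\<^sup>2) * s"
proof -
  define A where "A = mod_nat (R_ring n) (p\<^sup>2)"
  define V where "V = sym_vars n"
  interpret A: cring A unfolding A_def by (rule cring_mod_nat)
  interpret S: cring "S_ring n" by (rule cring_S_ring)
  have hom: "proj n (p\<^sup>2) \<in> Ring.ring_hom (S_ring n) A" unfolding A_def by (rule proj_hom)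
  interpret h: ring_hom_cring "S_ring n" A "proj n (p\<^sup>2)" using hom by unfold_locales
  obtain L where L: "L \<in> Ring.ring_hom A A" and frob: "\<And>r. r \<in> carrier A \<Longrightarrow>
      \<exists>t\<in>carrier A. L r = r [^]\<^bsub>A\<^esub> p \<oplus>\<^bsub>A\<^esub> (([p] \<cdot>\<^bsub>A\<^esub> \<one>\<^bsub>A\<^esub>) \<otimes>\<^bsub>A\<^esub> t)"
    using assms unfolding lifts_frobenius_def A_def by blast
  interpret L: ring_hom_cring A A L using L by unfold_locales
  have carr: "carrier A = proj n (p\<^sup>2) ` polys_in V" unfolding A_def V_def by (rule carrier_mod_nat)
  have "\<exists>t\<in>polys_in V. L (proj n (p\<^sup>2) (Xvar v)) = proj n (p\<^sup>2) (Xvar v ^ p + of_nat p * t)"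
    if "v \<in> V" for v
    using frob[of "proj n (p\<^sup>2) (Xvar v)"] that proj_frobenius_form[of "Xvar v" n _ "p\<^sup>2" p]
    unfolding carr A_def[symmetric] V_def by auto
  then obtain g where g: "\<And>v. v \<in> V \<Longrightarrow> g v \<in> polys_in V"
    "\<And>v. v \<in> V \<Longrightarrow> L (proj n (p\<^sup>2) (Xvar v)) = proj n (p\<^sup>2) (Xvar v ^ p + of_nat p * g v)"
    by metis
  define y where "y v = Xvar v ^ p + of_nat p * g v" for v
  have y: "poly_val y \<in> Ring.ring_hom (S_ring n) (S_ring n)"
    using g(1) by (intro poly_val_ring_hom)
      (simp add: y_def V_def polys_in_add polys_in_mult polys_in_power)
  have "(L \<circ> proj n (p\<^sup>2)) (det (symX n)) = (proj n (p\<^sup>2) \<circ> poly_val y) (det (symX n))"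
  proof (rule ring_hom_S_ring_eqI)
    show "L \<circ> proj n (p\<^sup>2) \<in> Ring.ring_hom (S_ring n) A" by (rule ring_hom_trans[OF hom L])
    show "proj n (p\<^sup>2) \<circ> poly_val y \<in> Ring.ring_hom (S_ring n) A" by (rule ring_hom_trans[OF y hom])
    show "cring A" by (rule A.is_cring)
  qed (use g(2) in \<open>auto simp: y_def V_def\<close>)
  moreover have "proj n (p\<^sup>2) (det (symX n)) = \<zero>\<^bsub>A\<^esub>"
    using proj_eq_zero_iff[of "det (symX n)" n "p\<^sup>2"] unfolding A_def
    by (auto intro: exI[of _ 1] exI[of _ 0])
  ultimately have "proj n (p\<^sup>2) (poly_val y (det (symX n))) = \<zero>\<^bsub>A\<^esub>"
    using L.hom_zero by simp
  moreover have "poly_val y (det (symX n)) \<in> polys_in (sym_vars n)"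
    using ring_hom_closed[OF y] by simp
  ultimately show ?thesis
    using that[of g] unfolding A_def y_def by (auto simp: proj_eq_zero_iff)
qed

section \<open>Determinants\<close>

lemma det_mat_Suc:
  "det (mat (Suc n) (Suc n) f) = (\<Sum>j<Suc n. f (0, j) * ((- 1) ^ j *
     det (mat n n (\<lambda>(i, k). f (Suc i, if k < j then k else Suc k)))))"
  for f :: "nat \<times> nat \<Rightarrow> 'a::comm_ring_1"
proof -
  let ?A = "mat (Suc n) (Suc n) f"
  have "mat_delete ?A 0 j = mat n n (\<lambda>(i, k). f (Suc i, if k < j then k else Suc k))" for j
    by (rule eq_matI) (auto simp: mat_delete_def)
  then show ?thesis
    by (subst laplace_expansion_row[of ?A "Suc n" 0]) (simp_all add: cofactor_def cong: sum.cong_simp)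
qed

lemma det_mat_0: "det (mat 0 0 f) = 1"
  by simp

lemma det_symmetric_3:
  fixes y :: "nat \<times> nat \<Rightarrow> 'a::comm_ring_1"
  shows "det (mat 3 3 (\<lambda>(i, j). y (min i j, max i j))) =
    y (0,0) * y (1,1) * y (2,2) + 2 * y (0,1) * y (0,2) * y (1,2)
    - y (0,0) * y (1,2) ^ 2 - y (1,1) * y (0,2) ^ 2 - y (2,2) * y (0,1) ^ 2"
  by (simp add: det_mat_Suc det_mat_0 numeral_eq_Suc lessThan_Suc) (simp add: algebra_simps)

text \<open>Terms are grouped by the number of diagonal factors. The last group is a quadratic form
  in \<open>P\<close>, \<open>Q\<close>, \<open>R\<close>, which splits into four linear forms in
  their square roots when these exist.\<close>

lemma det_symmetric_4:
  fixes y :: "nat \<times> nat \<Rightarrow> 'a::comm_ring_1"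
  defines "P \<equiv> y (0,1) * y (2,3)" and "Q \<equiv> y (0,2) * y (1,3)" and "R \<equiv> y (0,3) * y (1,2)"
  shows "det (mat 4 4 (\<lambda>(i, j). y (min i j, max i j))) =
    y (0,0) * y (1,1) * y (2,2) * y (3,3)
    - y (0,0) * y (1,1) * y (2,3) ^ 2 - y (0,0) * y (2,2) * y (1,3) ^ 2
    - y (0,0) * y (3,3) * y (1,2) ^ 2 - y (1,1) * y (2,2) * y (0,3) ^ 2
    - y (1,1) * y (3,3) * y (0,2) ^ 2 - y (2,2) * y (3,3) * y (0,1) ^ 2
    + 2 * (y (0,0) * (y (1,2) * y (1,3) * y (2,3)) + y (1,1) * (y (0,2) * y (0,3) * y (2,3))
         + y (2,2) * (y (0,1) * y (0,3) * y (1,3)) + y (3,3) * (y (0,1) * y (0,2) * y (1,2)))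
    + (P ^ 2 + Q ^ 2 + R ^ 2 - 2 * P * Q - 2 * P * R - 2 * Q * R)"
  unfolding P_def Q_def R_def
  by (simp add: det_mat_Suc det_mat_0 numeral_eq_Suc lessThan_Suc) (simp add: algebra_simps)

section \<open>Bordered determinants modulo a square\<close>

lemma det_border:
  fixes a :: "'a::comm_ring_1" and M :: "nat \<times> nat \<Rightarrow> 'a"
  assumes "\<And>i. i < n \<Longrightarrow> a dvd M (i, n)" "\<And>i. i < n \<Longrightarrow> a dvd M (n, i)"
  shows "a\<^sup>2 dvd det (mat (Suc n) (Suc n) M) - M (n, n) * det (mat n n M)"
proof -
  let ?A = "mat (Suc n) (Suc n) M"
  have "mat_delete ?A n n = mat n n M"
    by (rule eq_matI) (auto simp: mat_delete_def)
  \<comment> \<open>Expand along the last row and split off the diagonal term. In every other term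
    one factor \<open>a\<close> comes from the row entry and a second one from the last column of
    the minor.\<close>
  then have "det ?A - M (n, n) * det (mat n n M) = (\<Sum>j<n. M (n, j) * cofactor ?A n j)"
    by (subst laplace_expansion_row[of ?A "Suc n" n]) (simp_all add: cofactor_def)
  moreover have "a\<^sup>2 dvd M (n, j) * cofactor ?A n j" if j: "j < n" for j
  proof -
    have D: "mat_delete ?A n j \<in> carrier_mat n n"
      using mat_delete_carrier[of ?A "Suc n" "Suc n" n j] by simp
    \<comment> \<open>Deleting a column \<open>j < n\<close> moves the old last column to index
      \<open>n - 1\<close>.\<close>
    have "det (mat_delete ?A n j) =
        (\<Sum>i<n. mat_delete ?A n j $$ (i, n - 1) * cofactor (mat_delete ?A n j) i (n - 1))"
      using j by (intro laplace_expansion_column[OF D]) simp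
    also have "a dvd \<dots>"
      using j assms(1) by (intro dvd_sum dvd_mult2) (auto simp: mat_delete_def)
    finally show ?thesis
      using assms(2)[OF j] by (auto simp: cofactor_def power2_eq_square intro!: mult_dvd_mono)
  qed
  ultimately show ?thesis by (auto intro: dvd_sum)
qed

text \<open>Rows and columns are added one at a time by \<open>det_border\<close>. Each new diagonal
  entry \<open>1 + a * t\<close> contributes a factor, and modulo \<open>a\<^sup>2\<close> these
  accumulate into \<open>1 + a * r\<close>.\<close>

lemma det_corner_identity:
  fixes a :: "'a::comm_ring_1" and M :: "nat \<times> nat \<Rightarrow> 'a"
  assumes "k \<le> n"
    and "\<And>i j. i < n \<Longrightarrow> j < n \<Longrightarrow> k \<le> max i j \<Longrightarrow> a dvd M (i, j) - (if i = j then 1 else 0)"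
  shows "\<exists>r. a\<^sup>2 dvd det (mat n n M) - (1 + a * r) * det (mat k k M)"
  using assms
proof (induction n rule: dec_induct)
  case base
  show ?case by (intro exI[of _ 0]) simp
next
  case (step n)
  obtain r where r: "a\<^sup>2 dvd det (mat n n M) - (1 + a * r) * det (mat k k M)"
    using step.IH step.prems by (meson less_Suc_eq)
  have "a dvd M (n, n) - 1" using step.prems[of n n] step.hyps by simp
  then obtain t where t: "M (n, n) = 1 + a * t" by (metis add.commute diff_add_cancel dvdE)
  have "a\<^sup>2 dvd det (mat (Suc n) (Suc n) M) - M (n, n) * det (mat n n M)"
  proof (rule det_border)
    fix i assume "i < n"
    then show "a dvd M (i, n)" "a dvd M (n, i)"
      using step.prems[of i n] step.prems[of n i] step.hyps by simp_all
  qed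
  moreover have "a\<^sup>2 dvd M (n, n) * (det (mat n n M) - (1 + a * r) * det (mat k k M)) +
      a\<^sup>2 * (t * r * det (mat k k M))"
    by (intro dvd_add dvd_mult[OF r] dvd_triv_left)
  ultimately have "a\<^sup>2 dvd (det (mat (Suc n) (Suc n) M) - M (n, n) * det (mat n n M)) +
    (M (n, n) * (det (mat n n M) - (1 + a * r) * det (mat k k M)) + a\<^sup>2 * (t * r * det (mat k k M)))"
    by (rule dvd_add)
  also have "\<dots> = det (mat (Suc n) (Suc n) M) - (1 + a * (r + t)) * det (mat k k M)"
    unfolding t by (simp add: algebra_simps power2_eq_square)
  finally show ?case by blast
qed

lemma square_dvd_unit_cancel:
  fixes a d :: "'a::comm_ring_1"
  assumes "a\<^sup>2 dvd (1 + a * r) * d"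
  shows "a\<^sup>2 dvd d"
proof -
  \<comment> \<open>\<open>1 - a * r\<close> inverts \<open>1 + a * r\<close> modulo
    \<open>a\<^sup>2\<close>.\<close>
  have "d = (1 - a * r) * ((1 + a * r) * d) + a\<^sup>2 * (r\<^sup>2 * d)"
    by (simp add: algebra_simps power2_eq_square)
  then show ?thesis using assms by (metis dvd_add dvd_mult dvd_triv_left)
qed

section \<open>Graded specialisations\<close>

lemma lookup_single_times:
  "Poly_Mapping.lookup (Poly_Mapping.single w a * f) (w + e) = a * Poly_Mapping.lookup f e"
  for w :: "'m::cancel_comm_monoid_add" and a :: "'a::comm_semiring_1"
  by (induction f rule: poly_mapping_sum_induct)
    (simp_all add: distrib_left lookup_add mult_single lookup_single when_def)

lemma single_power: "\<exists>e'. Poly_Mapping.single e a ^ k = Poly_Mapping.single e' (a ^ k) \<and>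
    (\<forall>i. Poly_Mapping.lookup e' i = k * Poly_Mapping.lookup e i)"
  for e :: "'i \<Rightarrow>\<^sub>0 nat" and a :: "'a::comm_ring_1"
proof (induction k)
  case 0
  show ?case by (intro exI[of _ 0]) (simp add: single_one)
next
  case (Suc k)
  then obtain e' where "Poly_Mapping.single e a ^ k = Poly_Mapping.single e' (a ^ k)"
    "\<And>i. Poly_Mapping.lookup e' i = k * Poly_Mapping.lookup e i" by blast
  then show ?case by (intro exI[of _ "e + e'"]) (simp add: mult_single lookup_add)
qed

lemma monom_val_graded:
  fixes wt :: "'v \<Rightarrow> 'i \<Rightarrow>\<^sub>0 nat" and c :: "'v \<Rightarrow> 'a::comm_ring_1"
  shows "\<exists>e. monom_val (\<lambda>v. Poly_Mapping.single (wt v) (c v)) m = Poly_Mapping.single e (monom_val c m)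
    \<and> (\<forall>i. Poly_Mapping.lookup e i =
        (\<Sum>v\<in>Poly_Mapping.keys m. Poly_Mapping.lookup m v * Poly_Mapping.lookup (wt v) i))"
proof -
  have "\<exists>e. (\<Prod>v\<in>I. Poly_Mapping.single (wt v) (c v) ^ n v) = Poly_Mapping.single e (\<Prod>v\<in>I. c v ^ n v)
      \<and> (\<forall>i. Poly_Mapping.lookup e i = (\<Sum>v\<in>I. n v * Poly_Mapping.lookup (wt v) i))"
    if "finite I" for I and n :: "'v \<Rightarrow> nat"
    using that
  proof induction
    case empty
    show ?case by (intro exI[of _ 0]) (simp add: single_one)
  next
    case (insert v I)
    then obtain e where e: "(\<Prod>v\<in>I. Poly_Mapping.single (wt v) (c v) ^ n v) =
        Poly_Mapping.single e (\<Prod>v\<in>I. c v ^ n v)"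
      "\<And>i. Poly_Mapping.lookup e i = (\<Sum>v\<in>I. n v * Poly_Mapping.lookup (wt v) i)" by blast
    obtain e' where "Poly_Mapping.single (wt v) (c v) ^ n v = Poly_Mapping.single e' (c v ^ n v)"
      "\<And>i. Poly_Mapping.lookup e' i = n v * Poly_Mapping.lookup (wt v) i"
      using single_power[of "wt v" "c v" "n v"] by blast
    with e insert show ?case by (intro exI[of _ "e' + e"]) (simp add: mult_single lookup_add)
  qed
  then show ?thesis unfolding monom_val_def by simp
qed

text \<open>The variables with an index outside the k x k corner are sent to the entries of an identity block.\<close>

definition spec_wt :: "nat \<Rightarrow> nat \<times> nat \<Rightarrow> nat \<Rightarrow>\<^sub>0 nat" where
  "spec_wt k = (\<lambda>(i, j). if i < k \<and> j < k then Poly_Mapping.single i 1 + Poly_Mapping.single j 1 else 0)"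

definition spec_coeff :: "nat \<Rightarrow> (nat \<Rightarrow> nat \<Rightarrow> 'a::comm_ring_1) \<Rightarrow> nat \<times> nat \<Rightarrow> 'a" where
  "spec_coeff k \<xi> = (\<lambda>(i, j). if i < k \<and> j < k then \<xi> i j else if i = j then 1 else 0)"

text \<open>The corner is \<open>\<xi>\<close> multiplied on both sides by the diagonal matrix of
  the weights. Weights are kept apart from the coefficient ring, so comparing coefficients of a
  weight monomial gives identities in that ring.\<close>

definition spec :: "nat \<Rightarrow> (nat \<Rightarrow> nat \<Rightarrow> 'a::comm_ring_1) \<Rightarrow> nat \<times> nat \<Rightarrow> (nat \<Rightarrow>\<^sub>0 nat) \<Rightarrow>\<^sub>0 'a" where
  "spec k \<xi> v = Poly_Mapping.single (spec_wt k v) (spec_coeff k \<xi> v)"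

definition wvar :: "'i \<Rightarrow> ('i \<Rightarrow>\<^sub>0 nat) \<Rightarrow>\<^sub>0 'a::comm_ring_1" where
  "wvar i = Poly_Mapping.single (Poly_Mapping.single i 1) 1"

lemma wvar_power: "wvar i ^ k = Poly_Mapping.single (Poly_Mapping.single i k) 1"
  by (induction k) (simp_all add: wvar_def mult_single single_one flip: single_add)

lemma lookup_wvar_power_mult:
  "Poly_Mapping.lookup (wvar i ^ k * f) (Poly_Mapping.single i k + e) = Poly_Mapping.lookup f e"
  by (simp add: wvar_power lookup_single_times)

lemma spec_eq:
  "i < k \<Longrightarrow> j < k \<Longrightarrow> spec k \<xi> (i, j) = Poly_Mapping.single 0 (\<xi> i j) * (wvar i * wvar j)"
  by (simp add: spec_def spec_wt_def spec_coeff_def wvar_def mult_single)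

text \<open>A monomial of weight \<open>p\<close> in \<open>i\<close> plus \<open>p\<close> in
  \<open>j\<close> contains only corner variables with both indices in \<open>{i, j}\<close>. If
  \<open>i\<close> and \<open>j\<close> differ, those on the diagonal are zero, so
  \<open>(i, j)\<close> and \<open>(j, i)\<close> remain, and the weight of \<open>i\<close> shows
  that they occur \<open>p\<close> times in total. Variables outside the corner have value 0 or
  1.\<close>

lemma spec_coeff_monom_val:
  fixes \<xi> :: "nat \<Rightarrow> nat \<Rightarrow> 'a::comm_ring_1"
  assumes ij: "i < k" "j < k" and diag: "i = j \<or> \<xi> i i = 0 \<and> \<xi> j j = 0" and sym: "\<xi> i j = \<xi> j i"
    and e: "\<And>l. Poly_Mapping.lookup (Poly_Mapping.single i p + Poly_Mapping.single j p) l =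
      (\<Sum>v\<in>Poly_Mapping.keys m. Poly_Mapping.lookup m v * Poly_Mapping.lookup (spec_wt k v) l)"
  shows "monom_val (spec_coeff k \<xi>) m \<in> {0, \<xi> i j ^ p}"
proof (cases "\<exists>v\<in>Poly_Mapping.keys m. spec_coeff k \<xi> v = 0")
  case True
  then have "monom_val (spec_coeff k \<xi>) m = 0"
    unfolding monom_val_def by (intro prod_zero) (auto simp: in_keys_iff power_0_left intro!: bexI)
  then show ?thesis by simp
next
  case nz: False
  let ?K = "Poly_Mapping.keys m" and ?B = "{v. fst v < k \<and> snd v < k}"
  let ?t = "if i = j then 2 else 1 :: nat"
  have inner: "v \<in> {(i, j), (j, i)}" if v: "v \<in> ?K" "v \<in> ?B" for v
  proof -
    obtain a b where ab: "v = (a, b)" by force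
    \<comment> \<open>Weights are nonnegative, so an index of total weight zero is absent from every
      corner variable of \<open>m\<close>.\<close>
    have supp: "l \<in> {i, j}" if "l = a \<or> l = b" for l
    proof (rule ccontr)
      assume "l \<notin> {i, j}"
      then have "(\<Sum>v\<in>?K. Poly_Mapping.lookup m v * Poly_Mapping.lookup (spec_wt k v) l) = 0"
        by (subst e[symmetric]) (simp add: lookup_add lookup_single when_def)
      then have "Poly_Mapping.lookup m v * Poly_Mapping.lookup (spec_wt k v) l = 0"
        using v(1) by (simp add: sum_eq_0_iff)
      then show False
        using v that ab by (auto simp: in_keys_iff spec_wt_def lookup_add lookup_single when_def split: if_splits)
    qed
    have "\<xi> a b \<noteq> 0" using nz v ab by (auto simp: spec_coeff_def)
    then show ?thesis using supp[of a] supp[of b] diag ab by auto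
  qed
  have wt: "Poly_Mapping.lookup (spec_wt k v) i = (if v \<in> ?B then ?t else 0)" if "v \<in> ?K" for v
    using inner[OF that] ij
    by (auto simp: spec_wt_def lookup_add lookup_single when_def split: prod.splits)
  have "?t * p = (\<Sum>v\<in>?K. Poly_Mapping.lookup m v * Poly_Mapping.lookup (spec_wt k v) i)"
    by (subst e[symmetric]) (auto simp: lookup_add lookup_single when_def)
  also have "\<dots> = (\<Sum>v\<in>?K. ?t * (if v \<in> ?B then Poly_Mapping.lookup m v else 0))"
    by (intro sum.cong) (auto simp: wt)
  finally have p: "p = (\<Sum>v\<in>?K. if v \<in> ?B then Poly_Mapping.lookup m v else 0)"
    by (simp add: sum_distrib_left[symmetric] split: if_splits)
  have "spec_coeff k \<xi> v ^ Poly_Mapping.lookup m v = \<xi> i j ^ (if v \<in> ?B then Poly_Mapping.lookup m v else 0)"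
    if "v \<in> ?K" for v
    using inner[OF that] sym nz that by (cases v) (auto simp: spec_coeff_def split: if_splits)
  then have "monom_val (spec_coeff k \<xi>) m = (\<Prod>v\<in>?K. \<xi> i j ^ (if v \<in> ?B then Poly_Mapping.lookup m v else 0))"
    unfolding monom_val_def by (intro prod.cong) auto
  also have "\<dots> = \<xi> i j ^ p"
    unfolding p by (simp add: power_sum)
  finally show ?thesis by simp
qed

text \<open>Each monomial of \<open>g\<close> contributes an integer times 0 or
  \<open>\<xi> i j ^ p\<close>. This bounds the influence of the unknown corrections.\<close>

lemma lookup_spec:
  fixes \<xi> :: "nat \<Rightarrow> nat \<Rightarrow> 'a::comm_ring_1"
  assumes "i < k" "j < k" "i = j \<or> \<xi> i i = 0 \<and> \<xi> j j = 0" "\<xi> i j = \<xi> j i"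
  shows "\<exists>c. Poly_Mapping.lookup (poly_val (spec k \<xi>) g)
      (Poly_Mapping.single i p + Poly_Mapping.single j p) = of_int c * \<xi> i j ^ p"
proof (induction g rule: poly_mapping_sum_induct)
  case zero
  show ?case by (intro exI[of _ 0]) simp
next
  case (add m a g)
  let ?e = "Poly_Mapping.single i p + Poly_Mapping.single j p"
  obtain e where e: "monom_val (spec k \<xi>) m = Poly_Mapping.single e (monom_val (spec_coeff k \<xi>) m)"
    "\<And>l. Poly_Mapping.lookup e l =
      (\<Sum>v\<in>Poly_Mapping.keys m. Poly_Mapping.lookup m v * Poly_Mapping.lookup (spec_wt k v) l)"
    using monom_val_graded[of "spec_wt k" "spec_coeff k \<xi>" m] unfolding spec_def[symmetric] by blast
  have val: "poly_val (spec k \<xi>) (Poly_Mapping.single m a) =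
      Poly_Mapping.single e (of_int a * monom_val (spec_coeff k \<xi>) m)"
    using mult_single[of 0 "of_int a" e "monom_val (spec_coeff k \<xi>) m"] by (simp add: e(1))
  obtain c where c: "Poly_Mapping.lookup (poly_val (spec k \<xi>) g) ?e = of_int c * \<xi> i j ^ p"
    using add by blast
  have "\<exists>c'. Poly_Mapping.lookup (poly_val (spec k \<xi>) (Poly_Mapping.single m a)) ?e = of_int c' * \<xi> i j ^ p"
  proof (cases "e = ?e")
    case True
    have "monom_val (spec_coeff k \<xi>) m \<in> {0, \<xi> i j ^ p}"
      by (rule spec_coeff_monom_val[OF assms]) (simp only: e(2) flip: True)
    then show ?thesis
      unfolding val using True by (auto intro: exI[of _ 0])
  next
    case False
    then show ?thesis unfolding val by (intro exI[of _ 0]) (simp add: lookup_single_not_eq)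
  qed
  then obtain c' where "Poly_Mapping.lookup (poly_val (spec k \<xi>) (Poly_Mapping.single m a)) ?e = of_int c' * \<xi> i j ^ p" ..
  with c show ?case
    by (intro exI[of _ "c' + c"]) (simp add: poly_val_add lookup_add distrib_right)
qed

text \<open>Specialising kills the term with \<open>det (symX n)\<close>, so
  \<open>p\<^sup>2\<close> divides the specialised determinant. The block outside the corner is
  still the identity modulo \<open>p\<close> and is removed up to a unit.\<close>

lemma lifts_frobenius_specialise:
  fixes \<xi> :: "nat \<Rightarrow> nat \<Rightarrow> 'a::comm_ring_1"
  assumes lift: "lifts_frobenius (mod_nat (R_ring n) (p\<^sup>2)) p" and "k \<le> n" "p > 0"
    and det0: "det (mat k k (\<lambda>(i, j). spec k \<xi> (min i j, max i j))) = 0"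
  obtains g where "of_nat p ^ 2 dvd det (mat k k (\<lambda>(i, j).
    spec k \<xi> (min i j, max i j) ^ p + of_nat p * poly_val (spec k \<xi>) (g (min i j, max i j))))"
proof -
  obtain g h s where eq: "poly_val (\<lambda>v. Xvar v ^ p + of_nat p * g v) (det (symX n)) =
      h * det (symX n) + of_nat (p\<^sup>2) * s"
    using lifts_frobenius_imp_det[OF lift] .
  define x where "x = spec k \<xi>"
  define y where "y v = x v ^ p + of_nat p * poly_val x (g v)" for v
  define Mx My where "Mx = (\<lambda>(i, j). x (min i j, max i j))" and "My = (\<lambda>(i, j). y (min i j, max i j))"
  have outer: "x (i, j) = (if i = j then 1 else 0)" if "k \<le> max i j" for i j
    using that by (auto simp: x_def spec_def spec_wt_def spec_coeff_def single_one max_def split: if_splits)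
  \<comment> \<open>Taking \<open>a = 0\<close> turns the divisibility into an equality of the full
    determinant with that of the corner.\<close>
  have "\<exists>r. 0\<^sup>2 dvd det (mat n n Mx) - (1 + 0 * r) * det (mat k k Mx)"
    by (rule det_corner_identity[OF \<open>k \<le> n\<close>]) (auto simp: Mx_def outer min_def max_def)
  then have Mx0: "det (mat n n Mx) = 0" using det0 by (simp add: Mx_def x_def)
  have "poly_val x (poly_val (\<lambda>v. Xvar v ^ p + of_nat p * g v) (det (symX n))) = det (mat n n My)"
  proof -
    have "map_mat (poly_val x) (mat n n (\<lambda>(i, j). Xvar (min i j, max i j) ^ p + of_nat p * g (min i j, max i j)))
        = mat n n My"
      by (rule eq_matI)
        (auto simp: My_def y_def poly_val.hom_add poly_val.hom_mult poly_val.hom_power poly_val.hom_of_nat)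
    then show ?thesis
      unfolding poly_val_det_symX by (metis (no_types, lifting) poly_val.hom_det)
  qed
  moreover have "poly_val x (h * det (symX n) + of_nat (p\<^sup>2) * s) = (of_nat p)\<^sup>2 * poly_val x s"
    using Mx0 by (simp add: poly_val.hom_add poly_val.hom_mult poly_val.hom_power poly_val.hom_of_nat poly_val_det_symX Mx_def)
  ultimately have Myn: "(of_nat p)\<^sup>2 dvd det (mat n n My)"
    using eq by simp
  \<comment> \<open>The outer entries 0 and 1 are fixed by \<open>p\<close>-th powers, as
    \<open>p > 0\<close>, so only multiples of \<open>p\<close> disturb the identity block.\<close>
  have "\<exists>r. (of_nat p)\<^sup>2 dvd det (mat n n My) - (1 + of_nat p * r) * det (mat k k My)"
    using \<open>p > 0\<close>
    by (intro det_corner_identity[OF \<open>k \<le> n\<close>]) (auto simp: My_def y_def outer min_def max_def power_0_left)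
  then obtain r where "(of_nat p)\<^sup>2 dvd det (mat n n My) - (1 + of_nat p * r) * det (mat k k My)" ..
  from dvd_diff[OF Myn this] have "(of_nat p)\<^sup>2 dvd (1 + of_nat p * r) * det (mat k k My)" by simp
  then have "(of_nat p)\<^sup>2 dvd det (mat k k My)" by (rule square_dvd_unit_cancel)
  then show ?thesis using that[of g] by (simp add: My_def y_def x_def)
qed

lemma lookup_of_nat_mult: "Poly_Mapping.lookup (of_nat k * f) e = of_nat k * Poly_Mapping.lookup f e"
  for f :: "'m::cancel_comm_monoid_add \<Rightarrow>\<^sub>0 'a::comm_semiring_1"
  using lookup_single_times[of 0 "of_nat k" f e] by simp

lemma lookup_numeral_mult: "Poly_Mapping.lookup (numeral k * f) e = numeral k * Poly_Mapping.lookup f e"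
  for f :: "'m::cancel_comm_monoid_add \<Rightarrow>\<^sub>0 'a::comm_semiring_1"
  using lookup_of_nat_mult[of "numeral k" f e] by simp

section \<open>The prime 2\<close>

text \<open>With an even diagonal the determinant modulo 4 is twice an expression that matters only
  modulo 2, and from it the off-diagonal corrections \<open>a\<close>, \<open>b\<close>,
  \<open>c\<close> have disappeared.\<close>

lemma det_3_mod_4:
  fixes u g0 g1 g2 A B C a b c :: "'a::comm_ring_1"
  shows "\<exists>z. (4*u + 2*g0) * (2*g1) * (2*g2) + 2 * (A + 2*a) * (B + 2*b) * (C + 2*c)
    - (4*u + 2*g0) * (C + 2*c)^2 - (2*g1) * (B + 2*b)^2 - (2*g2) * (A + 2*a)^2
    = 2 * (A*B*C - g0*C^2 - g1*B^2 - g2*A^2) + 4 * z"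
proof
  show "(4*u + 2*g0) * (2*g1) * (2*g2) + 2 * (A + 2*a) * (B + 2*b) * (C + 2*c)
    - (4*u + 2*g0) * (C + 2*c)^2 - (2*g1) * (B + 2*b)^2 - (2*g2) * (A + 2*a)^2
    = 2 * (A*B*C - g0*C^2 - g1*B^2 - g2*A^2) + 4 * ((4*u + 2*g0)*g1*g2
      + (a*B*C + b*A*C + c*A*B + 2*a*b*C + 2*a*c*B + 2*b*c*A + 4*a*b*c)
      - u*(C + 2*c)^2 - 2*g0*(c*C + c^2) - 2*g1*(b*B + b^2) - 2*g2*(a*A + a^2))"
    by (simp add: algebra_simps power2_eq_square)
qed

lemma not_lifts_frobenius_2:
  assumes "n \<ge> 3"
  shows "\<not> lifts_frobenius (mod_nat (R_ring n) (2\<^sup>2)) 2"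
proof
  assume lift: "lifts_frobenius (mod_nat (R_ring n) (2\<^sup>2)) 2"
  \<comment> \<open>The entry 2 at \<open>(0,0)\<close> makes the determinant 2 - 2 = 0 while the
    diagonal stays even.\<close>
  define \<xi> :: "nat \<Rightarrow> nat \<Rightarrow> int" where "\<xi> i j = (if i \<noteq> j then 1 else if i = 0 then 2 else 0)" for i j
  let ?s = "\<lambda>i k. Poly_Mapping.single (i::nat) (k::nat)"
  define x where "x = spec 3 \<xi>"
  let ?w = "wvar :: nat \<Rightarrow> (nat \<Rightarrow>\<^sub>0 nat) \<Rightarrow>\<^sub>0 int"
  have x: "x (0,0) = 2 * ?w 0 ^ 2" "x (1,1) = 0" "x (2,2) = 0"
    "x (0,1) = ?w 0 * ?w 1" "x (0,2) = ?w 0 * ?w 2" "x (1,2) = ?w 1 * ?w 2"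
    by (simp_all add: x_def spec_eq \<xi>_def power2_eq_square)
  have "det (mat 3 3 (\<lambda>(i, j). x (min i j, max i j))) = 0"
    unfolding det_symmetric_3 x by (simp add: algebra_simps power2_eq_square)
  then obtain g where g: "of_nat 2 ^ 2 dvd det (mat 3 3 (\<lambda>(i, j).
      x (min i j, max i j) ^ 2 + of_nat 2 * poly_val x (g (min i j, max i j))))"
    using lifts_frobenius_specialise[OF lift assms, where \<xi> = \<xi>, folded x_def] by auto
  define \<gamma> where "\<gamma> v = poly_val x (g v)" for v
  define A B C u where "A = x (0,1) ^ 2" and "B = x (0,2) ^ 2" and "C = x (1,2) ^ 2"
    and "u = ?w 0 ^ 4"
  have x00: "x (0,0) ^ 2 = 4 * u"
    by (simp add: x u_def power_mult_distrib flip: power_mult)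
  have y: "x (0,0) ^ 2 + of_nat 2 * poly_val x (g (0,0)) = 4 * u + 2 * \<gamma> (0,0)"
    "x (1,1) ^ 2 + of_nat 2 * poly_val x (g (1,1)) = 2 * \<gamma> (1,1)"
    "x (2,2) ^ 2 + of_nat 2 * poly_val x (g (2,2)) = 2 * \<gamma> (2,2)"
    "x (0,1) ^ 2 + of_nat 2 * poly_val x (g (0,1)) = A + 2 * \<gamma> (0,1)"
    "x (0,2) ^ 2 + of_nat 2 * poly_val x (g (0,2)) = B + 2 * \<gamma> (0,2)"
    "x (1,2) ^ 2 + of_nat 2 * poly_val x (g (1,2)) = C + 2 * \<gamma> (1,2)"
    unfolding x00 x(2,3) A_def B_def C_def \<gamma>_def by simp_all
  obtain z where z: "det (mat 3 3 (\<lambda>(i, j). x (min i j, max i j) ^ 2 + of_nat 2 * poly_val x (g (min i j, max i j))))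
      = 2 * (A*B*C - \<gamma> (0,0) * C^2 - \<gamma> (1,1) * B^2 - \<gamma> (2,2) * A^2) + 4 * z"
    using det_3_mod_4[of u "\<gamma> (0,0)" "\<gamma> (1,1)" "\<gamma> (2,2)" A "\<gamma> (0,1)" B "\<gamma> (0,2)" C "\<gamma> (1,2)"]
    unfolding det_symmetric_3[of "\<lambda>v. x v ^ 2 + of_nat 2 * poly_val x (g v)"] y by blast
  obtain w where "2 * (A*B*C - \<gamma> (0,0) * C^2 - \<gamma> (1,1) * B^2 - \<gamma> (2,2) * A^2) + 4 * z = 4 * w"
    using g unfolding z by (auto elim: dvdE)
  then have "2 * (A*B*C - \<gamma> (0,0) * C^2 - \<gamma> (1,1) * B^2 - \<gamma> (2,2) * A^2) = 2 * (2 * (w - z))"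
    by (simp add: algebra_simps)
  \<comment> \<open>One factor 2 is cancelled, the coefficients being integers, which leaves an
    identity modulo 2.\<close>
  then have main: "A*B*C - \<gamma> (0,0) * C^2 - \<gamma> (1,1) * B^2 - \<gamma> (2,2) * A^2 = 2 * (w - z)"
    by (metis mult_left_cancel zero_neq_numeral)
  \<comment> \<open>The exponent of \<open>A*B*C\<close>, rearranged in four ways to match the
    weights peeled off each product.\<close>
  define e where "e = ?s 0 4 + ?s 1 4 + ?s 2 4"
  have e1: "e = ?s 1 4 + (?s 2 4 + ?s 0 4)" and e2: "e = ?s 0 4 + (?s 2 4 + ?s 1 4)"
    and e3: "e = ?s 0 4 + (?s 1 4 + ?s 2 4)" and e4: "e = ?s 0 4 + (?s 1 4 + (?s 2 4 + 0))"
    by (simp_all only: e_def ac_simps add_0_left add_0_right)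
  \<comment> \<open>By homogeneity the coefficient is an integer multiple of
    \<open>\<xi> i i ^ 2\<close>, which is 0 or 4.\<close>
  have coeff: "even (Poly_Mapping.lookup (\<gamma> (i,i)) (?s i 4))" if i: "i < 3" for i
  proof -
    obtain c where "Poly_Mapping.lookup (\<gamma> (i,i)) (?s i 2 + ?s i 2) = of_int c * \<xi> i i ^ 2"
      using lookup_spec[of i 3 i \<xi> "g (i,i)" 2] i unfolding \<gamma>_def x_def by auto
    then show ?thesis by (auto simp: \<xi>_def simp flip: single_add)
  qed
  have "1 - Poly_Mapping.lookup (\<gamma> (0,0)) (?s 0 4) - Poly_Mapping.lookup (\<gamma> (1,1)) (?s 1 4)
      - Poly_Mapping.lookup (\<gamma> (2,2)) (?s 2 4) = 2 * Poly_Mapping.lookup (w - z) e"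
  proof -
    have "\<gamma> (0,0) * C^2 = ?w 1 ^ 4 * (?w 2 ^ 4 * \<gamma> (0,0))" "\<gamma> (1,1) * B^2 = ?w 0 ^ 4 * (?w 2 ^ 4 * \<gamma> (1,1))"
      "\<gamma> (2,2) * A^2 = ?w 0 ^ 4 * (?w 1 ^ 4 * \<gamma> (2,2))" "A*B*C = ?w 0 ^ 4 * (?w 1 ^ 4 * (?w 2 ^ 4 * 1))"
      unfolding A_def B_def C_def x by (simp_all add: power_mult_distrib eval_nat_numeral ac_simps)
    note prods = this
    have "Poly_Mapping.lookup (\<gamma> (0,0) * C^2) e = Poly_Mapping.lookup (\<gamma> (0,0)) (?s 0 4)"
      unfolding e1 prods lookup_wvar_power_mult ..
    moreover have "Poly_Mapping.lookup (\<gamma> (1,1) * B^2) e = Poly_Mapping.lookup (\<gamma> (1,1)) (?s 1 4)"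
      unfolding e2 prods lookup_wvar_power_mult ..
    moreover have "Poly_Mapping.lookup (\<gamma> (2,2) * A^2) e = Poly_Mapping.lookup (\<gamma> (2,2)) (?s 2 4)"
      unfolding e3 prods lookup_wvar_power_mult ..
    moreover have "Poly_Mapping.lookup (A*B*C) e = 1"
      unfolding e4 prods lookup_wvar_power_mult by simp
    ultimately show ?thesis
      using arg_cong[OF main, of "\<lambda>f. Poly_Mapping.lookup f e"]
      by (simp only: lookup_minus lookup_numeral_mult)
  qed
  then show False using coeff[of 0] coeff[of 1] coeff[of 2] by presburger
qed

section \<open>Odd primes\<close>

lemma add_power_prime:
  fixes x y :: "'a::comm_ring_1"
  assumes "prime p"
  shows "\<exists>z. (x + y) ^ p = x ^ p + y ^ p + of_nat p * z"
proof -
  have p: "p > 0" using assms prime_gt_0_nat by simp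
  have "(x + y) ^ p = (\<Sum>k\<le>p. of_nat (p choose k) * x ^ k * y ^ (p - k))"
    by (rule binomial_ring)
  also have "{..p} = insert 0 (insert p {0<..<p})" using p by auto
  also have "(\<Sum>k\<in>\<dots>. of_nat (p choose k) * x ^ k * y ^ (p - k)) =
      y ^ p + (x ^ p + (\<Sum>k\<in>{0<..<p}. of_nat (p choose k) * x ^ k * y ^ (p - k)))"
    using p by simp
  also have "of_nat p dvd (\<Sum>k\<in>{0<..<p}. of_nat (p choose k) * x ^ k * y ^ (p - k))"
  proof (intro dvd_sum dvd_mult2)
    fix k assume "k \<in> {0<..<p}"
    then have "p dvd (p choose k)" using assms by (intro dvd_choose_prime) auto
    then show "(of_nat p :: 'a) dvd of_nat (p choose k)" by (auto elim!: dvdE)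
  qed
  then obtain z where "(\<Sum>k\<in>{0<..<p}. of_nat (p choose k) * x ^ k * y ^ (p - k)) = of_nat p * z" ..
  finally show ?thesis by (auto simp: ac_simps)
qed

lemma prod_3_perturb:
  "\<exists>n. (A + q * x) * (B + q * y) * (C + q * z) = A * B * C + q * n" for q :: "'a::comm_ring_1"
  by (rule exI[of _ "x*B*C + y*A*C + z*A*B + q*(x*y*C + x*z*B + y*z*A) + q*q*x*y*z"])
    (simp add: algebra_simps)

text \<open>At squares the form splits into linear factors. One of them, \<open>a + b - c\<close>,
  is \<open>- q * \<psi>\<close>; the others are \<open>2*c\<close>, \<open>2*a\<close>,
  \<open>- 2*b\<close> modulo \<open>q\<close>. The gradient simplifies likewise, for instance
  \<open>a\<^sup>2 - b\<^sup>2 - c\<^sup>2\<close> is \<open>- 2*b*c\<close> modulo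
  \<open>q\<close>, so the whole first-order part has the factor \<open>a*b*c\<close>.\<close>

lemma quadric_perturb:
  fixes q a b c \<psi> W :: "'a::comm_ring_1"
  assumes c: "c = a + b + q * \<psi>"
  shows "\<exists>z. (a*a*W + q * (a*l + q*l'))^2 + (b*b*W + q * (b*m + q*m'))^2 + (c*c*W + q * (c*n + q*n'))^2
      - 2 * (a*a*W + q * (a*l + q*l')) * (b*b*W + q * (b*m + q*m'))
      - 2 * (a*a*W + q * (a*l + q*l')) * (c*c*W + q * (c*n + q*n'))
      - 2 * (b*b*W + q * (b*m + q*m')) * (c*c*W + q * (c*n + q*n'))
    = q * (a*b*c * (8 * (\<psi> * W^2) - 4 * (W * l + W * m - W * n))) + q^2 * z"
proof -
  define F where "F x y z = x^2 + y^2 + z^2 - 2*x*y - 2*x*z - 2*y*z" for x y z :: 'a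
  have F_add: "F (x + q*x') (y + q*y') (z + q*z') = F x y z
      + q * (2*x'*(x - y - z) + 2*y'*(y - x - z) + 2*z'*(z - x - y)) + q^2 * F x' y' z'"
    for x y z x' y' z'
    by (simp add: F_def algebra_simps power2_eq_square)
  have fact: "F (a*a*W) (b*b*W) (c*c*W) = W^2 * ((a + b + c) * (a + b - c) * (a - b + c) * (a - b - c))"
    by (simp add: F_def algebra_simps power2_eq_square)
  have factors: "a + b - c = - (q * \<psi>)" "a + b + c = 2*c + q * (- \<psi>)" "a - b + c = 2*a + q * \<psi>"
    "- (a - b - c) = 2*b + q * \<psi>"
    unfolding c by simp_all
  obtain k where k: "(2*c + q * (- \<psi>)) * (2*a + q * \<psi>) * (2*b + q * \<psi>) = 2*c*(2*a)*(2*b) + q * k"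
    using prod_3_perturb by blast
  have "(a + b + c) * (a + b - c) * (a - b + c) * (a - b - c) =
      q * \<psi> * ((a + b + c) * (a - b + c) * (- (a - b - c)))"
    unfolding factors(1) by (simp add: algebra_simps)
  also have "\<dots> = q * \<psi> * (8*(a*b*c) + q * k)"
    unfolding factors(2-4) k by (simp add: algebra_simps)
  finally have F0: "F (a*a*W) (b*b*W) (c*c*W) = q * (a*b*c*(8*(\<psi>*W^2))) + q^2 * (W^2 * \<psi> * k)"
    unfolding fact by (simp add: algebra_simps power2_eq_square)
  define k1 k2 k3 where "k1 = - 2*\<psi>*(c - b) + q*\<psi>^2" and "k2 = - 2*\<psi>*(c - a) + q*\<psi>^2"
    and "k3 = 2*\<psi>*(a + b) + q*\<psi>^2"
  have lin: "a*a*W - b*b*W - c*c*W = W * (- 2*b*c + q*k1)" "b*b*W - a*a*W - c*c*W = W * (- 2*a*c + q*k2)"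
    "c*c*W - a*a*W - b*b*W = W * (2*a*b + q*k3)"
    unfolding k1_def k2_def k3_def c by (simp_all add: algebra_simps power2_eq_square)
  show ?thesis
    unfolding F_def[symmetric] F0 lin
      F_add[of "a*a*W" "a*l + q*l'" "b*b*W" "b*m + q*m'" "c*c*W" "c*n + q*n'"]
    by (rule exI[of _ "W^2*\<psi>*k + 2*a*l*W*k1 + 2*l'*W*(- 2*b*c + q*k1) + 2*b*m*W*k2 + 2*m'*W*(- 2*a*c + q*k2)
        + 2*c*n*W*k3 + 2*n'*W*(2*a*b + q*k3) + F (a*l + q*l') (b*m + q*m') (c*n + q*n')"])
      (simp add: algebra_simps power2_eq_square)
qed

text \<open>Diagonal entries are multiples of \<open>q\<close>: terms with two or more of them are
  absorbed by \<open>q^2 * z\<close>, and in terms with exactly one the other three entries count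
  only modulo \<open>q\<close>, where their product has the factor \<open>a*b*c\<close>. The part
  without diagonal entries is \<open>quadric_perturb\<close>.\<close>

lemma det_4_perturb:
  fixes y \<gamma> :: "nat \<times> nat \<Rightarrow> 'a::comm_ring_1" and w :: "nat \<Rightarrow> 'a"
  assumes c: "c = a + b + q * \<psi>"
    and y: "\<And>i. i < 4 \<Longrightarrow> y (i,i) = q * \<gamma> (i,i)"
      "y (0,1) = a * (w 0 * w 1) + q * \<gamma> (0,1)" "y (2,3) = a * (w 2 * w 3) + q * \<gamma> (2,3)"
      "y (0,2) = b * (w 0 * w 2) + q * \<gamma> (0,2)" "y (1,3) = b * (w 1 * w 3) + q * \<gamma> (1,3)"
      "y (0,3) = c * (w 0 * w 3) + q * \<gamma> (0,3)" "y (1,2) = c * (w 1 * w 2) + q * \<gamma> (1,2)"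
  defines "W \<equiv> w 0 * w 1 * w 2 * w 3"
  shows "\<exists>z. det (mat 4 4 (\<lambda>(i, j). y (min i j, max i j))) = q * (a*b*c * (8 * (\<psi> * W^2)
      + 2 * ((w 1 * w 2 * w 3)^2 * \<gamma> (0,0) + (w 0 * w 2 * w 3)^2 * \<gamma> (1,1)
           + (w 0 * w 1 * w 3)^2 * \<gamma> (2,2) + (w 0 * w 1 * w 2)^2 * \<gamma> (3,3))
      - 4 * (W * (w 2 * w 3 * \<gamma> (0,1) + w 0 * w 1 * \<gamma> (2,3))
           + W * (w 1 * w 3 * \<gamma> (0,2) + w 0 * w 2 * \<gamma> (1,3))
           - W * (w 1 * w 2 * \<gamma> (0,3) + w 0 * w 3 * \<gamma> (1,2))))) + q^2 * z"
proof -
  let ?l = "w 2 * w 3 * \<gamma> (0,1) + w 0 * w 1 * \<gamma> (2,3)"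
  let ?m = "w 1 * w 3 * \<gamma> (0,2) + w 0 * w 2 * \<gamma> (1,3)"
  let ?n = "w 1 * w 2 * \<gamma> (0,3) + w 0 * w 3 * \<gamma> (1,2)"
  have PQR: "y (0,1) * y (2,3) = a*a*W + q * (a * ?l + q * (\<gamma> (0,1) * \<gamma> (2,3)))"
    "y (0,2) * y (1,3) = b*b*W + q * (b * ?m + q * (\<gamma> (0,2) * \<gamma> (1,3)))"
    "y (0,3) * y (1,2) = c*c*W + q * (c * ?n + q * (\<gamma> (0,3) * \<gamma> (1,2)))"
    unfolding y W_def by (simp_all add: algebra_simps)
  obtain z where z: "(y (0,1) * y (2,3))^2 + (y (0,2) * y (1,3))^2 + (y (0,3) * y (1,2))^2
      - 2 * (y (0,1) * y (2,3)) * (y (0,2) * y (1,3)) - 2 * (y (0,1) * y (2,3)) * (y (0,3) * y (1,2))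
      - 2 * (y (0,2) * y (1,3)) * (y (0,3) * y (1,2))
    = q * (a*b*c * (8 * (\<psi> * W^2) - 4 * (W * ?l + W * ?m - W * ?n))) + q^2 * z"
    unfolding PQR using quadric_perturb[OF c] by blast
  obtain n0 where n0: "y (1,2) * y (1,3) * y (2,3) = c * (w 1 * w 2) * (b * (w 1 * w 3)) * (a * (w 2 * w 3)) + q * n0"
    unfolding y using prod_3_perturb by blast
  obtain n1 where n1: "y (0,2) * y (0,3) * y (2,3) = b * (w 0 * w 2) * (c * (w 0 * w 3)) * (a * (w 2 * w 3)) + q * n1"
    unfolding y using prod_3_perturb by blast
  obtain n2 where n2: "y (0,1) * y (0,3) * y (1,3) = a * (w 0 * w 1) * (c * (w 0 * w 3)) * (b * (w 1 * w 3)) + q * n2"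
    unfolding y using prod_3_perturb by blast
  obtain n3 where n3: "y (0,1) * y (0,2) * y (1,2) = a * (w 0 * w 1) * (b * (w 0 * w 2)) * (c * (w 1 * w 2)) + q * n3"
    unfolding y using prod_3_perturb by blast
  have d: "y (0,0) = q * \<gamma> (0,0)" "y (1,1) = q * \<gamma> (1,1)" "y (2,2) = q * \<gamma> (2,2)" "y (3,3) = q * \<gamma> (3,3)"
    using y(1) by simp_all
  show ?thesis
    unfolding det_symmetric_4 z n0 n1 n2 n3 d
    by (rule exI[of _ "z + 2 * (\<gamma> (0,0)*n0 + \<gamma> (1,1)*n1 + \<gamma> (2,2)*n2 + \<gamma> (3,3)*n3)
        + q*q*\<gamma> (0,0)*\<gamma> (1,1)*\<gamma> (2,2)*\<gamma> (3,3)
        - \<gamma> (0,0)*\<gamma> (1,1)*y (2,3)^2 - \<gamma> (0,0)*\<gamma> (2,2)*y (1,3)^2 - \<gamma> (0,0)*\<gamma> (3,3)*y (1,2)^2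
        - \<gamma> (1,1)*\<gamma> (2,2)*y (0,3)^2 - \<gamma> (1,1)*\<gamma> (3,3)*y (0,2)^2 - \<gamma> (2,2)*\<gamma> (3,3)*y (0,1)^2"])
      (simp add: algebra_simps power2_eq_square)
qed

lemma coeff_1_X_plus_1_power: "poly.coeff ([:1, 1:] ^ k) 0 = (1::int) \<and> poly.coeff ([:1, 1:] ^ k) 1 = int k"
  by (induction k) (simp_all add: coeff_pCons)

text \<open>Compare coefficients of \<open>s^(p+1)\<close> with \<open>s = [:0, 1:]\<close>. The
  factor \<open>s^p\<close> is a shift, \<open>\<psi>\<close> has linear coefficient 1, and every
  other contribution is zero or a multiple of \<open>p\<close>, so 8 is left modulo
  \<open>p\<close>.\<close>

lemma frobenius_defect_obstruction:
  fixes \<psi> \<zeta> :: "int poly"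
  assumes p: "p > 1" and \<psi>: "[:1, 1:] ^ p = [:0, 1:] ^ p + 1 + of_nat p * \<psi>"
    and eq: "[:0, 1:] ^ p * 1 * [:1, 1:] ^ p *
      (8 * \<psi> + of_int k * [:0, 1:] ^ p + of_int l + of_int m * [:1, 1:] ^ p) = of_nat p * \<zeta>"
  shows "p dvd 8"
proof -
  let ?s = "[:0, 1:] ^ p :: int poly" and ?t = "[:1, 1:] ^ p :: int poly"
  define T where "T = 8 * \<psi> + of_int k * ?s + of_int l + of_int m * ?t"
  have s: "?s = Polynomial.monom 1 p" by (simp add: monom_altdef)
  have coeffs: "poly.coeff (of_nat p * f) i = int p * poly.coeff f i" "poly.coeff (of_int c * f) i = c * poly.coeff f i"
    "poly.coeff (8 * f) i = 8 * poly.coeff f i" "poly.coeff (of_int c) 1 = 0" for f :: "int poly" and c i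
    by (simp_all add: of_nat_poly of_int_poly numeral_poly)
  have t1: "poly.coeff ?t 1 = int p" "poly.coeff ?t 0 = 1" using coeff_1_X_plus_1_power[of p] by simp_all
  have "int p = int p * poly.coeff \<psi> 1"
    using arg_cong[OF \<psi>, of "\<lambda>f. poly.coeff f 1"] p by (simp add: t1 s coeffs del: One_nat_def)
  then have "poly.coeff \<psi> 1 = 1" using p by simp
  then have T1: "poly.coeff T 1 = 8 + m * int p"
    using p unfolding T_def by (simp add: coeffs t1 s del: One_nat_def)
  have "poly.coeff (?s * (?t * T)) (p + 1) = poly.coeff (?t * T) 1"
    by (simp add: s coeff_monom_mult)
  also have "\<dots> = poly.coeff T 1 + int p * poly.coeff T 0"
    by (simp add: coeff_mult t1[unfolded One_nat_def])
  finally have "8 + m * int p + int p * poly.coeff T 0 = int p * poly.coeff \<zeta> (p + 1)"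
    using arg_cong[OF eq, of "\<lambda>f. poly.coeff f (p + 1)"] T1 unfolding T_def[symmetric] by (simp add: coeffs mult.assoc)
  then have "8 = int p * (poly.coeff \<zeta> (p + 1) - m - poly.coeff T 0)" by (simp add: algebra_simps)
  then have "int p dvd int 8" by (metis dvd_triv_left of_nat_numeral)
  then show ?thesis by (simp only: of_nat_dvd_iff)
qed

lemma not_lifts_frobenius_odd:
  assumes "n \<ge> 4" "prime p" "odd p"
  shows "\<not> lifts_frobenius (mod_nat (R_ring n) (p\<^sup>2)) p"
proof
  assume lift: "lifts_frobenius (mod_nat (R_ring n) (p\<^sup>2)) p"
  have p1: "p > 1" using assms(2) prime_gt_1_nat by simp
  \<comment> \<open>With \<open>s = [:0, 1:]\<close>, the three pairs of complementary entries are
    \<open>s\<close>, 1 and \<open>s + 1\<close>, so one linear factor of the zero-diagonal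
    determinant is \<open>s + 1 - (s + 1)\<close>.\<close>
  define \<xi> :: "nat \<Rightarrow> nat \<Rightarrow> int poly" where "\<xi> i j = (if i = j then 0
    else if {i, j} = {0, 1} \<or> {i, j} = {2, 3} then [:0, 1:] else if {i, j} = {0, 2} \<or> {i, j} = {1, 3} then 1
    else [:1, 1:])" for i j
  have \<xi>: "\<xi> i i = 0" "\<xi> 0 1 = [:0, 1:]" "\<xi> 2 3 = [:0, 1:]" "\<xi> 0 2 = 1" "\<xi> 1 3 = 1"
    "\<xi> 0 3 = [:1, 1:]" "\<xi> 1 2 = [:1, 1:]" "\<xi> i j = \<xi> j i" for i j
    by (simp_all add: \<xi>_def doubleton_eq_iff insert_commute)
  define x where "x = spec 4 \<xi>"
  let ?w = "wvar :: nat \<Rightarrow> (nat \<Rightarrow>\<^sub>0 nat) \<Rightarrow>\<^sub>0 int poly"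
  let ?C = "Poly_Mapping.single (0 :: nat \<Rightarrow>\<^sub>0 nat) :: int poly \<Rightarrow> _"
  have C_power: "?C f ^ k = ?C (f ^ k)" for f k
    by (induction k) (simp_all add: mult_single)
  have x: "x (i, j) = ?C (\<xi> i j) * (?w i * ?w j)" if "i < 4" "j < 4" for i j
    using that by (simp add: x_def spec_eq)
  have "det (mat 4 4 (\<lambda>(i, j). x (min i j, max i j))) = 0"
  proof -
    define S where "S = ?C [:0, 1:]"
    have "?C [:1, 1:] = S + 1" by (simp add: S_def one_pCons flip: single_one single_add)
    then have xs: "x (0,0) = 0" "x (1,1) = 0" "x (2,2) = 0" "x (3,3) = 0"
      "x (0,1) = S * (?w 0 * ?w 1)" "x (2,3) = S * (?w 2 * ?w 3)" "x (0,2) = ?w 0 * ?w 2"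
      "x (1,3) = ?w 1 * ?w 3" "x (0,3) = (S + 1) * (?w 0 * ?w 3)" "x (1,2) = (S + 1) * (?w 1 * ?w 2)"
      by (simp_all add: x \<xi>(1-7) S_def single_one del: One_nat_def)
    show ?thesis
      unfolding det_symmetric_4 xs by (simp add: algebra_simps power2_eq_square)
  qed
  then obtain g where g: "of_nat p ^ 2 dvd det (mat 4 4 (\<lambda>(i, j).
      x (min i j, max i j) ^ p + of_nat p * poly_val x (g (min i j, max i j))))"
    using lifts_frobenius_specialise[OF lift assms(1), where \<xi> = \<xi>, folded x_def] p1 by auto
  define \<gamma> where "\<gamma> v = poly_val x (g v)" for v
  obtain \<psi> :: "int poly" where \<psi>: "[:1, 1:] ^ p = [:0, 1:] ^ p + 1 + of_nat p * \<psi>"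
    using add_power_prime[OF assms(2), of "[:0, 1:] :: int poly" 1] by (simp add: pCons_one[symmetric] del: pCons_one) (auto simp: pCons_one)
  define a b c where "a = ?C ([:0, 1:] ^ p)" and "b = ?C 1" and "c = ?C ([:1, 1:] ^ p)"
  have c: "c = a + b + of_nat p * ?C \<psi>"
    using mult_single[of "0 :: nat \<Rightarrow>\<^sub>0 nat" "of_nat p" 0 \<psi>] unfolding a_def b_def c_def \<psi> by (simp add: single_add)
  have xp: "x (i, j) ^ p = ?C (\<xi> i j ^ p) * (?w i ^ p * ?w j ^ p)" if "i < 4" "j < 4" for i j
    using that by (simp add: x power_mult_distrib C_power)
  define w where "w i = ?w i ^ p" for i
  define W where "W = w 0 * w 1 * w 2 * w 3"
  define E where "E = 8 * (?C \<psi> * W^2)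
      + 2 * ((w 1 * w 2 * w 3)^2 * \<gamma> (0,0) + (w 0 * w 2 * w 3)^2 * \<gamma> (1,1)
           + (w 0 * w 1 * w 3)^2 * \<gamma> (2,2) + (w 0 * w 1 * w 2)^2 * \<gamma> (3,3))
      - 4 * (W * (w 2 * w 3 * \<gamma> (0,1) + w 0 * w 1 * \<gamma> (2,3))
           + W * (w 1 * w 3 * \<gamma> (0,2) + w 0 * w 2 * \<gamma> (1,3))
           - W * (w 1 * w 2 * \<gamma> (0,3) + w 0 * w 3 * \<gamma> (1,2)))"
  have "\<exists>z. det (mat 4 4 (\<lambda>(i, j). x (min i j, max i j) ^ p + of_nat p * poly_val x (g (min i j, max i j))))
      = of_nat p * (a*b*c * E) + (of_nat p)^2 * z"
    unfolding E_def W_def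
    by (rule det_4_perturb[where y = "\<lambda>v. x v ^ p + of_nat p * poly_val x (g v)", OF c])
      (use p1 in \<open>simp_all add: xp \<xi>(1-7) \<gamma>_def a_def b_def c_def w_def power_0_left del: One_nat_def\<close>)
  then obtain z z' where "of_nat p * (a*b*c * E) + (of_nat p)^2 * z = (of_nat p)^2 * z'"
    using g by (auto elim!: dvdE)
  then have "of_nat p * (a*b*c * E) = of_nat p * (of_nat p * (z' - z))"
    by (simp add: algebra_simps power2_eq_square)
  then have main: "a*b*c * E = of_nat p * (z' - z)"
    using p1 by (metis mult_left_cancel of_nat_eq_0_iff not_one_less_zero)
  let ?s = "\<lambda>i. Poly_Mapping.single (i::nat) p"
  \<comment> \<open>The exponent of \<open>W^2\<close>: weight \<open>2 * p\<close> in each of the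
    four indices.\<close>
  define e where "e = (?s 0 + ?s 0) + (?s 1 + ?s 1) + (?s 2 + ?s 2) + (?s 3 + ?s 3)"
  have lw: "Poly_Mapping.lookup (w i * f) (?s i + d) = Poly_Mapping.lookup f d" for i f d
    unfolding w_def by (rule lookup_wvar_power_mult)
  have l\<psi>: "Poly_Mapping.lookup (?C \<psi> * W^2) e = \<psi>"
  proof -
    have "e = ?s 0 + (?s 0 + (?s 1 + (?s 1 + (?s 2 + (?s 2 + (?s 3 + (?s 3 + 0)))))))"
      by (simp only: e_def ac_simps add_0_left add_0_right)
    moreover have "?C \<psi> * W^2 = w 0 * (w 0 * (w 1 * (w 1 * (w 2 * (w 2 * (w 3 * (w 3 * ?C \<psi>)))))))"
      by (simp add: W_def power2_eq_square ac_simps)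
    ultimately show ?thesis by (simp only: lw) simp
  qed
  \<comment> \<open>By homogeneity this is a multiple of \<open>\<xi> i i ^ p\<close>, which is
    zero.\<close>
  have ldiag: "Poly_Mapping.lookup ((w j * w k * w l)^2 * \<gamma> (i,i)) e = 0"
    if "e = ?s j + (?s j + (?s k + (?s k + (?s l + (?s l + (?s i + ?s i))))))" "i < 4" for i j k l
  proof -
    have "(w j * w k * w l)^2 * \<gamma> (i,i) = w j * (w j * (w k * (w k * (w l * (w l * \<gamma> (i,i))))))"
      by (simp add: power2_eq_square ac_simps)
    then have "Poly_Mapping.lookup ((w j * w k * w l)^2 * \<gamma> (i,i)) e = Poly_Mapping.lookup (\<gamma> (i,i)) (?s i + ?s i)"
      unfolding that(1) by (simp only: lw)
    also have "\<dots> = 0"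
      using lookup_spec[of i 4 i \<xi> "g (i,i)" p] that(2) p1 unfolding \<gamma>_def x_def by (auto simp: \<xi>(1) power_0_left)
    finally show ?thesis .
  qed
  have loff: "\<exists>m. Poly_Mapping.lookup (W * (w k * w l * \<gamma> (i,j))) e = of_int m * \<xi> i j ^ p"
    if "e = ?s i + (?s j + (?s k + (?s l + (?s k + (?s l + (?s i + ?s j))))))" "W = w i * w j * w k * w l"
      "i < 4" "j < 4" for i j k l
  proof -
    have "W * (w k * w l * \<gamma> (i,j)) = w i * (w j * (w k * (w l * (w k * (w l * \<gamma> (i,j))))))"
      by (simp add: that(2) ac_simps)
    then have "Poly_Mapping.lookup (W * (w k * w l * \<gamma> (i,j))) e = Poly_Mapping.lookup (\<gamma> (i,j)) (?s i + ?s j)"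
      unfolding that(1) by (simp only: lw)
    then show ?thesis
      using lookup_spec[of i 4 j \<xi> "g (i,j)" p] that(3,4) \<xi>(1,8) unfolding \<gamma>_def x_def by auto
  qed
  have d0: "Poly_Mapping.lookup ((w 1 * w 2 * w 3)^2 * \<gamma> (0,0)) e = 0"
    and d1: "Poly_Mapping.lookup ((w 0 * w 2 * w 3)^2 * \<gamma> (1,1)) e = 0"
    and d2: "Poly_Mapping.lookup ((w 0 * w 1 * w 3)^2 * \<gamma> (2,2)) e = 0"
    and d3: "Poly_Mapping.lookup ((w 0 * w 1 * w 2)^2 * \<gamma> (3,3)) e = 0"
    by (rule ldiag, simp only: e_def ac_simps, simp)+
  obtain m01 m23 m02 m13 m03 m12 where m:
    "Poly_Mapping.lookup (W * (w 2 * w 3 * \<gamma> (0,1))) e = of_int m01 * [:0, 1:] ^ p"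
    "Poly_Mapping.lookup (W * (w 0 * w 1 * \<gamma> (2,3))) e = of_int m23 * [:0, 1:] ^ p"
    "Poly_Mapping.lookup (W * (w 1 * w 3 * \<gamma> (0,2))) e = of_int m02"
    "Poly_Mapping.lookup (W * (w 0 * w 2 * \<gamma> (1,3))) e = of_int m13"
    "Poly_Mapping.lookup (W * (w 1 * w 2 * \<gamma> (0,3))) e = of_int m03 * [:1, 1:] ^ p"
    "Poly_Mapping.lookup (W * (w 0 * w 3 * \<gamma> (1,2))) e = of_int m12 * [:1, 1:] ^ p"
    using loff[of 0 1 2 3] loff[of 2 3 0 1] loff[of 0 2 1 3] loff[of 1 3 0 2] loff[of 0 3 1 2] loff[of 1 2 0 3]
    unfolding \<xi>(2-7) by (auto simp: e_def W_def ac_simps)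
  \<comment> \<open>All corrections combine into integer multiples of \<open>s^p\<close>, 1 and
    \<open>(s + 1)^p\<close>, the shape treated by
    \<open>frobenius_defect_obstruction\<close>.\<close>
  have lE: "Poly_Mapping.lookup E e = 8 * \<psi> + of_int (- 4 * (m01 + m23)) * [:0, 1:] ^ p
      + of_int (- 4 * (m02 + m13)) + of_int (4 * (m03 + m12)) * [:1, 1:] ^ p"
    unfolding E_def distrib_left[of W] lookup_add lookup_minus lookup_numeral_mult l\<psi> d0 d1 d2 d3 m
    by (simp add: algebra_simps)
  have "a * b * c = ?C ([:0, 1:] ^ p * 1 * [:1, 1:] ^ p)"
    unfolding a_def b_def c_def by (simp only: mult_single add_0_left)
  then have "[:0, 1:] ^ p * 1 * [:1, 1:] ^ p * Poly_Mapping.lookup E e = Poly_Mapping.lookup (a * b * c * E) (0 + e)"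
    by (simp only: lookup_single_times)
  then have "[:0, 1:] ^ p * 1 * [:1, 1:] ^ p * Poly_Mapping.lookup E e = of_nat p * Poly_Mapping.lookup (z' - z) e"
    unfolding main add_0_left lookup_of_nat_mult .
  then have "p dvd 8"
    unfolding lE by (rule frobenius_defect_obstruction[OF p1 \<psi>])
  then have "p dvd 2 ^ 3" by simp
  then have "p dvd 2" using assms(2) by (rule prime_dvd_power[rotated])
  then have "p = 2" using assms(2) primes_dvd_imp_eq two_is_prime_nat by blast
  then show False using assms(3) by simp
qed

section \<open>Dickson polynomials\<close>

text \<open>Dickson polynomials of the first kind: the \<open>k\<close>-th power sum of two elements
  with sum \<open>s\<close> and product \<open>q\<close>, given by Newton's recurrence. Hence the
  value 2 at \<open>k = 0\<close>.\<close>

fun dickson :: "nat \<Rightarrow> 'a::comm_ring_1 \<Rightarrow> 'a \<Rightarrow> 'a" where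
  "dickson 0 s q = 2"
| "dickson (Suc 0) s q = s"
| "dickson (Suc (Suc k)) s q = s * dickson (Suc k) s q - q * dickson k s q"

lemma (in comm_ring_hom) hom_dickson: "hom (dickson k s q) = dickson k (hom s) (hom q)"
proof -
  have "hom 2 = 2" using hom_add[of 1 1] by simp
  then show ?thesis
    by (induction k s q rule: dickson.induct) (simp_all add: hom_minus hom_mult)
qed

lemma dickson_add_mult: "dickson k (\<alpha> + \<beta>) (\<alpha> * \<beta>) = \<alpha> ^ k + \<beta> ^ k"
proof -
  have "s = \<alpha> + \<beta> \<Longrightarrow> q = \<alpha> * \<beta> \<Longrightarrow> dickson k s q = \<alpha> ^ k + \<beta> ^ k" for s q
    by (induction k s q rule: dickson.induct) (simp_all add: algebra_simps)
  then show ?thesis by simp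
qed

lemma dickson_scale: "d ^ k * dickson k s q = dickson k (d * s) (d\<^sup>2 * q)"
proof (induction k s q rule: dickson.induct)
  case (3 k s q)
  have "d ^ Suc (Suc k) * dickson (Suc (Suc k)) s q =
      (d * s) * (d ^ Suc k * dickson (Suc k) s q) - (d\<^sup>2 * q) * (d ^ k * dickson k s q)"
    by (simp add: algebra_simps power2_eq_square)
  then show ?case by (simp only: 3 dickson.simps)
qed simp_all

lemma dickson_in_polys_in: "s \<in> polys_in V \<Longrightarrow> q \<in> polys_in V \<Longrightarrow> dickson k s q \<in> polys_in V"
proof (induction k s q rule: dickson.induct)
  case (1 s q)
  show ?case using polys_in_of_int[of 2] by simp
next
  case (3 k s q)
  then show ?case
    using polys_in_add[OF polys_in_mult polys_in_uminus[OF polys_in_mult]]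
    by (simp only: dickson.simps diff_conv_add_uminus)
qed simp

text \<open>If s = \<alpha> + \<beta> and q = \<alpha>\<beta>, the following is \<alpha>^i \<beta>^j + \<alpha>^j \<beta>^i.\<close>

definition sym_power_sum :: "'a::comm_ring_1 \<Rightarrow> 'a \<Rightarrow> nat \<Rightarrow> nat \<Rightarrow> 'a" where
  "sym_power_sum s q i j = q ^ min i j * dickson (if i \<le> j then j - i else i - j) s q"

text \<open>This is multiplication of \<open>\<alpha>^i \<beta>^j + \<alpha>^j \<beta>^i\<close> by
  \<open>\<alpha> + \<beta>\<close>; for \<open>i < j\<close> it is the Dickson recurrence times
  \<open>q ^ i\<close>.\<close>

lemma sym_power_sum_step:
  "s * sym_power_sum s q i j = sym_power_sum s q (Suc i) j + sym_power_sum s q i (Suc j)"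
proof -
  have swap: "sym_power_sum s q i j = sym_power_sum s q j i" for i j
    by (auto simp: sym_power_sum_def min.commute)
  have less: "s * sym_power_sum s q i j = sym_power_sum s q (Suc i) j + sym_power_sum s q i (Suc j)"
    if "i < j" for i j
  proof -
    from that obtain k where "j = i + Suc k" by (metis less_iff_Suc_add add_Suc_right)
    then show ?thesis by (simp add: sym_power_sum_def Suc_diff_le algebra_simps)
  qed
  consider "i < j" | "i = j" | "j < i" by linarith
  then show ?thesis
  proof cases
    case 2
    then show ?thesis by (simp add: sym_power_sum_def algebra_simps)
  next
    case 3
    then show ?thesis using less[of j i] swap by (simp add: add.commute)
  qed (rule less)
qed

lemma sum_binomial_Suc:
  fixes f :: "nat \<Rightarrow> 'a::comm_ring_1"
  shows "(\<Sum>k\<le>Suc n. of_nat (Suc n choose k) * f k) = (\<Sum>k\<le>n. of_nat (n choose k) * (f (Suc k) + f k))"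
proof -
  have "(\<Sum>k\<le>Suc n. of_nat (n choose k) * f k) = f 0 + (\<Sum>k\<le>n. of_nat (n choose Suc k) * f (Suc k))"
    by (subst sum.atMost_Suc_shift) simp
  then have "(\<Sum>k\<le>n. of_nat (n choose k) * f k) = f 0 + (\<Sum>k\<le>n. of_nat (n choose Suc k) * f (Suc k))"
    by (simp add: binomial_eq_0)
  then show ?thesis
    by (subst sum.atMost_Suc_shift) (simp add: distrib_left distrib_right sum.distrib del: sum.atMost_Suc)
qed

text \<open>The symmetrised binomial theorem, doubled because each term is added to its mirror
  image.\<close>

lemma binomial_dickson:
  "2 * s ^ n = (\<Sum>k\<le>n. of_nat (n choose k) * sym_power_sum s q k (n - k))"
proof (induction n)
  case 0
  show ?case by (simp add: sym_power_sum_def)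
next
  case (Suc n)
  have "2 * s ^ Suc n = s * (2 * s ^ n)" by simp
  also have "\<dots> = (\<Sum>k\<le>n. of_nat (n choose k) * (s * sym_power_sum s q k (n - k)))"
    unfolding Suc by (simp add: sum_distrib_left algebra_simps)
  also have "\<dots> = (\<Sum>k\<le>n. of_nat (n choose k) *
      (sym_power_sum s q (Suc k) (Suc n - Suc k) + sym_power_sum s q k (Suc n - k)))"
    by (intro sum.cong) (simp_all add: sym_power_sum_step Suc_diff_le)
  finally show ?case by (simp only: sum_binomial_Suc)
qed

text \<open>In \<open>binomial_dickson\<close> both outer terms are \<open>dickson p s q\<close>,
  and the inner binomial coefficients are divisible by \<open>p\<close>.\<close>

lemma dickson_prime:
  fixes s q :: "'a::comm_ring_1"
  assumes "prime p" "odd p"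
  shows "\<exists>z. dickson p s q = s ^ p + of_nat p * z"
proof -
  let ?E = "sym_power_sum s q"
  have p: "p > 0" using assms prime_gt_0_nat by simp
  have "{..p} = insert 0 (insert p {0<..<p})" using p by auto
  then have "2 * s ^ p = 2 * dickson p s q + (\<Sum>k\<in>{0<..<p}. of_nat (p choose k) * ?E k (p - k))"
    using p by (simp add: binomial_dickson[of s p q] sym_power_sum_def)
  moreover have "of_nat p dvd (\<Sum>k\<in>{0<..<p}. of_nat (p choose k) * ?E k (p - k))"
  proof (intro dvd_sum dvd_mult2)
    fix k assume "k \<in> {0<..<p}"
    then have "p dvd (p choose k)" using assms by (intro dvd_choose_prime) auto
    then show "(of_nat p :: 'a) dvd of_nat (p choose k)" by (auto elim!: dvdE)
  qed
  ultimately obtain z where z: "2 * s ^ p = 2 * dickson p s q + of_nat p * z" by (metis dvdE)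
  \<comment> \<open>A general ring does not allow cancelling 2; writing \<open>1 = p - 2 * m\<close>
    replaces the division modulo \<open>p\<close>.\<close>
  obtain m where m: "p = 2 * m + 1" using assms(2) by (rule oddE)
  have "dickson p s q - s ^ p = of_nat p * (dickson p s q - s ^ p) - of_nat m * (2 * dickson p s q - 2 * s ^ p)"
    by (subst (3) m) (simp add: algebra_simps)
  also have "\<dots> = of_nat p * (dickson p s q - s ^ p + of_nat m * z)"
    unfolding z by (simp add: algebra_simps)
  finally show ?thesis by (metis diff_add_cancel add.commute)
qed

text \<open>Reduction modulo the quadratic equation of \<open>r\<close>. The coefficients come from
  the base ring and are quantified before \<open>r\<close>, so the same ones serve both
  roots.\<close>

lemma (in comm_ring_hom) dickson_quadratic:
  "\<exists>x y. \<forall>r. r * r = hom e * r - hom f \<longrightarrow> dickson k r (hom q) = hom x + hom y * r"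
proof (induction k rule: less_induct)
  case (less k)
  consider "k = 0" | "k = 1" | l where "k = Suc (Suc l)" by (metis One_nat_def not0_implies_Suc)
  then show ?case
  proof cases
    case 1
    have "hom 2 = 2" using hom_add[of 1 1] by simp
    with 1 show ?thesis by (intro exI[of _ 2] exI[of _ 0]) simp
  next
    case 2
    then show ?thesis by (intro exI[of _ 0] exI[of _ 1]) simp
  next
    case 3
    obtain x y where xy: "\<And>r. r * r = hom e * r - hom f \<Longrightarrow> dickson (Suc l) r (hom q) = hom x + hom y * r"
      using less[of "Suc l"] 3 by auto
    obtain x' y' where xy': "\<And>r. r * r = hom e * r - hom f \<Longrightarrow> dickson l r (hom q) = hom x' + hom y' * r"
      using less[of l] 3 by auto
    show ?thesis
    proof (intro exI allI impI)
      fix r assume r: "r * r = hom e * r - hom f"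
      have "dickson k r (hom q) = hom x * r + hom y * (r * r) - hom q * (hom x' + hom y' * r)"
        unfolding 3 by (simp add: xy[OF r] xy'[OF r] algebra_simps)
      then show "dickson k r (hom q) = hom (- y * f - q * x') + hom (x + y * e - q * y') * r"
        unfolding r by (simp add: hom_distribs algebra_simps)
    qed
  qed
qed

text \<open>The factor theorem for \<open>hom s - r\<close>, with the cofactor reduced to a linear
  expression in \<open>r\<close> that is again common to both roots.\<close>

lemma (in comm_ring_hom) dickson_diff_quadratic:
  "\<exists>x y. \<forall>r. r * r = hom e * r - hom f \<longrightarrow>
    dickson k (hom s) (hom q) - dickson k r (hom q) = (hom s - r) * (hom x + hom y * r)"
proof (induction k rule: less_induct)
  case (less k)
  consider "k = 0" | "k = 1" | l where "k = Suc (Suc l)" by (metis One_nat_def not0_implies_Suc)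
  then show ?case
  proof cases
    case 1
    then show ?thesis by (intro exI[of _ 0]) simp
  next
    case 2
    then show ?thesis by (intro exI[of _ 1] exI[of _ 0]) simp
  next
    case 3
    obtain x y where xy: "\<And>r. r * r = hom e * r - hom f \<Longrightarrow>
        dickson (Suc l) (hom s) (hom q) - dickson (Suc l) r (hom q) = (hom s - r) * (hom x + hom y * r)"
      using less[of "Suc l"] 3 by auto
    obtain x' y' where xy': "\<And>r. r * r = hom e * r - hom f \<Longrightarrow>
        dickson l (hom s) (hom q) - dickson l r (hom q) = (hom s - r) * (hom x' + hom y' * r)"
      using less[of l] 3 by auto
    obtain u v where uv: "\<And>r. r * r = hom e * r - hom f \<Longrightarrow> dickson (Suc l) r (hom q) = hom u + hom v * r"
      using dickson_quadratic by blast
    show ?thesis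
    proof (intro exI allI impI)
      fix r assume r: "r * r = hom e * r - hom f"
      have "dickson k (hom s) (hom q) - dickson k r (hom q) =
          hom s * (dickson (Suc l) (hom s) (hom q) - dickson (Suc l) r (hom q))
          + (hom s - r) * dickson (Suc l) r (hom q)
          - hom q * (dickson l (hom s) (hom q) - dickson l r (hom q))"
        unfolding 3 by (simp add: algebra_simps)
      also have "\<dots> = (hom s - r) * (hom (s * x + u - q * x') + hom (s * y + v - q * y') * r)"
        unfolding xy[OF r] xy'[OF r] unfolding uv[OF r] by (simp add: hom_distribs algebra_simps)
      finally show "dickson k (hom s) (hom q) - dickson k r (hom q) =
        (hom s - r) * (hom (s * x + u - q * x') + hom (s * y + v - q * y') * r)" .
    qed
  qed
qed

text \<open>Half the determinant of the symmetric matrix with diagonal 2 d0, 2 d1, 2 d2.\<close>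

definition half_det :: "'a::comm_ring_1 \<Rightarrow> 'a \<Rightarrow> 'a \<Rightarrow> 'a \<Rightarrow> 'a \<Rightarrow> 'a \<Rightarrow> 'a" where
  "half_det d0 d1 d2 a b c = a*b*c + 4*d0*d1*d2 - d0*c\<^sup>2 - d1*b\<^sup>2 - d2*a\<^sup>2"

lemma (in comm_ring_hom) hom_half_det:
  "hom (half_det d0 d1 d2 a b c) = half_det (hom d0) (hom d1) (hom d2) (hom a) (hom b) (hom c)"
proof -
  have "hom 2 = 2" using hom_add[of 1 1] by simp
  then have "hom 4 = 4" using hom_add[of 2 2] by simp
  then show ?thesis by (simp add: half_det_def hom_distribs)
qed

text \<open>Times \<open>- d0\<close>, the half determinant is a monic quadratic in
  \<open>d0 * c\<close>, and the two roots sum to the product of the other off-diagonal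
  entries.\<close>

lemma half_det_factor:
  fixes d0 :: "'a::comm_ring_1"
  assumes "\<alpha> * \<beta> = d0 * d1" "\<gamma> * \<delta> = d0 * d2"
  shows "(d0*c - (\<beta>*\<gamma> + \<alpha>*\<delta>)) * (d0*c - (\<alpha>*\<gamma> + \<beta>*\<delta>)) = - (d0 * half_det d0 d1 d2 (\<alpha> + \<beta>) (\<gamma> + \<delta>) c)"
proof -
  have "- (d0 * half_det d0 d1 d2 (\<alpha> + \<beta>) (\<gamma> + \<delta>) c) = d0*c*(d0*c) - d0*c*((\<alpha> + \<beta>)*(\<gamma> + \<delta>))
      + (d0*d1)*(\<gamma> + \<delta>)\<^sup>2 + (d0*d2)*(\<alpha> + \<beta>)\<^sup>2 - 4*(d0*d1)*(d0*d2)"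
    by (simp add: half_det_def algebra_simps power2_eq_square)
  then show ?thesis
    unfolding assms[symmetric] by (simp add: algebra_simps power2_eq_square)
qed

lemma quadratic_splits:
  fixes s q :: "'a::alg_closed_field"
  shows "\<exists>\<alpha> \<beta>. \<alpha> + \<beta> = s \<and> \<alpha> * \<beta> = q"
proof -
  obtain \<alpha> where "poly [:q, - s, 1:] \<alpha> = 0"
    using alg_closed_imp_poly_has_root[of "[:q, - s, 1:]"] by auto
  then have "\<alpha> + (s - \<alpha>) = s \<and> \<alpha> * (s - \<alpha>) = q" by (simp add: algebra_simps)
  then show ?thesis by blast
qed

text \<open>
  Over an algebraic closure - d0 * half_det is the product of d0 * c - r over the two roots r of a
  quadratic with coefficients in the base ring. D_p(d0 c) - D_p(r) is divisible by d0 * c - r, and the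
  product of the two cofactors is symmetric in the roots, hence lies in the base ring.
\<close>

lemma half_det_dickson:
  fixes d0 d1 d2 a b c :: "'a::idom"
  shows "\<exists>F. d0 ^ p * half_det (d0 ^ p) (d1 ^ p) (d2 ^ p)
      (dickson p a (d0 * d1)) (dickson p b (d0 * d2)) (dickson p c (d1 * d2)) =
    d0 * half_det d0 d1 d2 a b c * F"
proof -
  \<comment> \<open>This map is injective, so identities proved in the closure descend to the base
    ring.\<close>
  define h :: "'a \<Rightarrow> 'a fract alg_closure" where "h = to_ac \<circ> to_fract"
  interpret h: comm_ring_hom h by standard (simp_all add: h_def)
  have inj: "h x = h y \<longleftrightarrow> x = y" for x y by (simp add: h_def)
  obtain \<alpha> \<beta> where ab: "\<alpha> + \<beta> = h a" "\<alpha> * \<beta> = h (d0 * d1)" using quadratic_splits by blast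
  obtain \<gamma> \<delta> where cd: "\<gamma> + \<delta> = h b" "\<gamma> * \<delta> = h (d0 * d2)" using quadratic_splits by blast
  define r1 r2 where "r1 = \<beta>*\<gamma> + \<alpha>*\<delta>" and "r2 = \<alpha>*\<gamma> + \<beta>*\<delta>"
  define e f where "e = a * b" and "f = d0 * (d1*b\<^sup>2 + d2*a\<^sup>2 - 4*d0*d1*d2)"
  have four: "h 4 = 4" using h.hom_add[of 1 1] h.hom_add[of 2 2] by simp
  have sum: "r1 + r2 = h e"
    unfolding r1_def r2_def e_def h.hom_mult ab(1)[symmetric] cd(1)[symmetric] by (simp add: algebra_simps)
  have prod: "r1 * r2 = h f"
  proof -
    have "h f = (\<alpha>*\<beta>) * (\<gamma> + \<delta>)\<^sup>2 + (\<gamma>*\<delta>) * (\<alpha> + \<beta>)\<^sup>2 - 4 * (\<alpha>*\<beta>) * (\<gamma>*\<delta>)"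
      unfolding f_def ab cd by (simp add: h.hom_add h.hom_minus h.hom_mult h.hom_power four algebra_simps power2_eq_square)
    then show ?thesis unfolding r1_def r2_def by (simp add: algebra_simps power2_eq_square)
  qed
  have roots: "r1 * r1 = h e * r1 - h f" "r2 * r2 = h e * r2 - h f"
    unfolding sum[symmetric] prod[symmetric] by (simp_all add: algebra_simps)
  \<comment> \<open>Scaling by \<open>d0\<close> makes \<open>s\<close> comparable with the roots;
    by \<open>dickson_scale\<close> it costs a factor \<open>d0 ^ p\<close>.\<close>
  define q s where "q = d0\<^sup>2 * (d1 * d2)" and "s = d0 * c"
  have q: "h q = (\<alpha> * \<beta>) * (\<gamma> * \<delta>)"
    unfolding ab cd q_def by (simp add: h.hom_mult power2_eq_square algebra_simps)
  \<comment> \<open>The two summands of each root multiply to \<open>h q\<close>, so the Dickson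
    polynomial raises them to the power \<open>p\<close>.\<close>
  have D1: "dickson p r1 (h q) = \<beta>^p*\<gamma>^p + \<alpha>^p*\<delta>^p"
    using dickson_add_mult[of p "\<beta>*\<gamma>" "\<alpha>*\<delta>"] unfolding q r1_def by (simp add: power_mult_distrib ac_simps)
  have D2: "dickson p r2 (h q) = \<alpha>^p*\<gamma>^p + \<beta>^p*\<delta>^p"
    using dickson_add_mult[of p "\<alpha>*\<gamma>" "\<beta>*\<delta>"] unfolding q r2_def by (simp add: power_mult_distrib ac_simps)
  have Ds: "dickson p (h s) (h q) = h d0 ^ p * h (dickson p c (d1 * d2))"
    unfolding s_def q_def h.hom_dickson[symmetric] dickson_scale[symmetric]
    by (simp add: h.hom_mult h.hom_power)
  obtain x y where xy: "\<And>r. r * r = h e * r - h f \<Longrightarrow>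
      dickson p (h s) (h q) - dickson p r (h q) = (h s - r) * (h x + h y * r)"
    using h.dickson_diff_quadratic[of e f p s q] by blast
  \<comment> \<open>\<open>half_det_factor\<close> is used twice: for the \<open>p\<close>-th powers
    and, once the factors \<open>h s - r\<close> are extracted, for the original entries.\<close>
  have "- h (d0 ^ p * half_det (d0 ^ p) (d1 ^ p) (d2 ^ p)
      (dickson p a (d0 * d1)) (dickson p b (d0 * d2)) (dickson p c (d1 * d2)))
    = - (h d0 ^ p * half_det (h d0 ^ p) (h d1 ^ p) (h d2 ^ p) (\<alpha>^p + \<beta>^p) (\<gamma>^p + \<delta>^p) (h (dickson p c (d1 * d2))))"
    by (simp add: h.hom_mult h.hom_power h.hom_half_det h.hom_dickson flip: dickson_add_mult)
      (simp add: ab cd h.hom_mult)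
  also have "\<dots> = (dickson p (h s) (h q) - dickson p r1 (h q)) * (dickson p (h s) (h q) - dickson p r2 (h q))"
    unfolding D1 D2 Ds
    by (rule half_det_factor[symmetric]) (use ab cd in \<open>simp_all add: h.hom_mult flip: power_mult_distrib\<close>)
  also have "\<dots> = ((h s - r1) * (h s - r2)) * (h x * h x + h x * h y * (r1 + r2) + h y * h y * (r1 * r2))"
    unfolding xy[OF roots(1)] xy[OF roots(2)] by (simp add: algebra_simps)
  also have "(h s - r1) * (h s - r2) = - (h d0 * half_det (h d0) (h d1) (h d2) (h a) (h b) (h c))"
    unfolding s_def r1_def r2_def h.hom_mult ab(1)[symmetric] cd(1)[symmetric]
    by (rule half_det_factor) (use ab cd in \<open>simp_all add: h.hom_mult\<close>)
  also have "\<dots> * (h x * h x + h x * h y * (r1 + r2) + h y * h y * (r1 * r2)) =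
      - h (d0 * half_det d0 d1 d2 a b c * (x * x + x * y * e + y * y * f))"
    unfolding sum prod by (simp add: h.hom_add h.hom_minus h.hom_mult h.hom_power h.hom_half_det)
  finally show ?thesis by (auto simp: inj)
qed

text \<open>For indeterminates the powers of \<open>d0\<close> in \<open>half_det_dickson\<close>
  cancel, because \<open>Xvar (0,0)\<close> is prime and does not divide \<open>?P\<close>.\<close>

lemma half_det_Xvar_dvd:
  "half_det (Xvar (0,0)) (Xvar (1,1)) (Xvar (2,2)) (Xvar (0,1)) (Xvar (0,2)) (Xvar (1,2)) dvd
    half_det (Xvar (0,0) ^ Suc k) (Xvar (1,1) ^ Suc k) (Xvar (2,2) ^ Suc k) (dickson (Suc k) (Xvar (0,1)) (Xvar (0,0) * Xvar (1,1)))
      (dickson (Suc k) (Xvar (0,2)) (Xvar (0,0) * Xvar (2,2))) (dickson (Suc k) (Xvar (1,2)) (Xvar (1,1) * Xvar (2,2)))"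
    (is "?P dvd ?A")
proof -
  obtain F where F: "Xvar (0,0) ^ Suc k * ?A = Xvar (0,0) * ?P * F"
    using half_det_dickson by blast
  \<comment> \<open>A point where \<open>Xvar (0,0)\<close> vanishes but \<open>?P\<close> is
    1.\<close>
  define x :: "nat \<times> nat \<Rightarrow> int" where "x v = (if fst v = snd v then 0 else 1)" for v
  have P1: "poly_val x ?P = 1"
    by (simp add: poly_val.hom_half_det) (simp add: half_det_def x_def)
  have "poly_val (\<lambda>_. 1) (Xvar (0,0)) \<noteq> (0::int)" by simp
  then have "Xvar (0,0) \<noteq> 0" by (metis poly_val_0)
  then have "Xvar (0,0) ^ k * ?A = ?P * F" using F by (simp add: mult.assoc)
  moreover have "\<not> Xvar (0,0) dvd ?P"
  proof
    assume "Xvar (0,0) dvd ?P"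
    then obtain G where "?P = Xvar (0,0) * G" ..
    then have "poly_val x ?P = poly_val x (Xvar (0,0)) * poly_val x G" by (metis poly_val.hom_mult)
    then show False using P1 by (simp add: x_def)
  qed
  ultimately show ?thesis by (rule Xvar_power_dvd_mult_left)
qed

section \<open>The lift for n = 3\<close>

lemma int_power_prime: "prime p \<Longrightarrow> int p dvd c ^ p - c"
proof (induction c rule: int_induct[where k = 0])
  case base
  then show ?case by (simp add: power_0_left prime_gt_0_nat)
next
  case (step1 c)
  obtain z where "(c + 1) ^ p = c ^ p + 1 + int p * z"
    using add_power_prime[OF step1.prems, of c 1] by auto
  then have eq: "(c + 1) ^ p - (c + 1) = (c ^ p - c) + int p * z" by simp
  show ?case unfolding eq using step1 by simp
next
  case (step2 c)
  obtain z where "c ^ p = (c - 1) ^ p + 1 + int p * z"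
    using add_power_prime[OF step2.prems, of "c - 1" 1] by auto
  then have eq: "(c - 1) ^ p - (c - 1) = (c ^ p - c) - int p * z" by simp
  show ?case unfolding eq using step2 by simp
qed

lemma of_nat_dvd_of_int: "int p dvd k \<Longrightarrow> (of_nat p :: 'a::comm_ring_1) dvd of_int k"
  by (auto elim!: dvdE)

text \<open>Converse of \<open>lifts_frobenius_imp_det\<close>. The substitution preserves the ideal
  of the determinant and \<open>p\<^sup>2\<close>, so it descends. The congruence spreads from
  variables to all polynomials because \<open>p\<close>-th powers are additive modulo
  \<open>p\<close> and integers satisfy Fermat's little theorem.\<close>

lemma lifts_frobeniusI:
  fixes y :: "nat \<times> nat \<Rightarrow> zpoly"
  assumes p: "prime p"
    and y: "\<And>v. v \<in> sym_vars n \<Longrightarrow> y v \<in> polys_in (sym_vars n)"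
    and frob: "\<And>v. v \<in> sym_vars n \<Longrightarrow> of_nat p dvd y v - Xvar v ^ p"
    and det: "poly_val y (det (symX n)) = h * det (symX n) + of_nat (p\<^sup>2) * s"
  shows "lifts_frobenius (mod_nat (R_ring n) (p\<^sup>2)) p"
proof -
  define A where "A = mod_nat (R_ring n) (p\<^sup>2)"
  define \<pi> where "\<pi> = proj n (p\<^sup>2)"
  define V where "V = sym_vars n"
  interpret A: cring A unfolding A_def by (rule cring_mod_nat)
  interpret S: cring "S_ring n" by (rule cring_S_ring)
  have hom: "\<pi> \<in> Ring.ring_hom (S_ring n) A" unfolding A_def \<pi>_def by (rule proj_hom)
  interpret h: ring_hom_cring "S_ring n" A \<pi> using hom by unfold_locales
  have carr: "carrier A = \<pi> ` polys_in V" unfolding A_def V_def \<pi>_def by (rule carrier_mod_nat)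
  have yS: "poly_val y \<in> Ring.ring_hom (S_ring n) (S_ring n)" by (rule poly_val_ring_hom[OF y])
  have y_in: "poly_val y f \<in> polys_in V" if "f \<in> polys_in V" for f
    using ring_hom_closed[OF yS] that by (simp add: V_def)
  have diff_in: "f - g \<in> polys_in V" if "f \<in> polys_in V" "g \<in> polys_in V" for f g
    unfolding diff_conv_add_uminus using that by (intro polys_in_add polys_in_uminus)
  have eq_iff: "\<pi> f = \<pi> g \<longleftrightarrow> (\<exists>h s. f - g = h * det (symX n) + of_nat (p\<^sup>2) * s)"
    if fg: "f \<in> polys_in V" "g \<in> polys_in V" for f g
  proof -
    have "\<pi> f = \<pi> (f - g) \<oplus>\<^bsub>A\<^esub> \<pi> g"
      using h.hom_add[of "f - g" g] fg diff_in by (simp add: V_def)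
    moreover have "\<pi> (f - g) \<in> carrier A" "\<pi> g \<in> carrier A" using fg diff_in carr by auto
    ultimately have "\<pi> f = \<pi> g \<longleftrightarrow> \<pi> (f - g) = \<zero>\<^bsub>A\<^esub>"
      by (metis A.add.l_cancel_one' A.add.m_comm)
    then show ?thesis
      using proj_eq_zero_iff[of "f - g" n "p\<^sup>2"] diff_in fg unfolding A_def \<pi>_def V_def by simp
  qed
  have wd: "\<pi> (poly_val y f) = \<pi> (poly_val y g)"
    if fg: "f \<in> polys_in V" "g \<in> polys_in V" "\<pi> f = \<pi> g" for f g
  proof -
    obtain h' s' where "f - g = h' * det (symX n) + of_nat (p\<^sup>2) * s'" using eq_iff fg by blast
    then have "poly_val y f - poly_val y g = poly_val y (h' * det (symX n) + of_nat (p\<^sup>2) * s')"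
      by (metis poly_val.hom_minus)
    also have "\<dots> = (poly_val y h' * h) * det (symX n) + of_nat (p\<^sup>2) * (poly_val y h' * s + poly_val y s')"
      unfolding poly_val.hom_add poly_val.hom_mult det poly_val.hom_of_nat by (simp add: algebra_simps)
    finally show ?thesis using eq_iff y_in fg by blast
  qed
  define L where "L r = \<pi> (poly_val y (SOME f. f \<in> polys_in V \<and> \<pi> f = r))" for r
  have L: "L (\<pi> f) = \<pi> (poly_val y f)" if "f \<in> polys_in V" for f
  proof -
    have "\<exists>g. g \<in> polys_in V \<and> \<pi> g = \<pi> f" using that by blast
    from someI_ex[OF this] show ?thesis unfolding L_def using wd that by blast
  qed
  have "L \<in> Ring.ring_hom A A"
  proof (rule ring_hom_memI)
    fix r assume "r \<in> carrier A"
    then show "L r \<in> carrier A" using L y_in unfolding carr by auto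
  next
    fix r r' assume "r \<in> carrier A" "r' \<in> carrier A"
    then obtain f f' where f: "f \<in> polys_in V" "r = \<pi> f" "f' \<in> polys_in V" "r' = \<pi> f'"
      unfolding carr by blast
    have "r \<otimes>\<^bsub>A\<^esub> r' = \<pi> (f * f')" "r \<oplus>\<^bsub>A\<^esub> r' = \<pi> (f + f')"
      using h.hom_mult[of f f'] h.hom_add[of f f'] f by (simp_all add: V_def)
    then show "L (r \<otimes>\<^bsub>A\<^esub> r') = L r \<otimes>\<^bsub>A\<^esub> L r'" "L (r \<oplus>\<^bsub>A\<^esub> r') = L r \<oplus>\<^bsub>A\<^esub> L r'"
      using f h.hom_mult[of "poly_val y f" "poly_val y f'"] h.hom_add[of "poly_val y f" "poly_val y f'"] y_in
      by (simp_all add: L polys_in_add polys_in_mult poly_val.hom_add poly_val.hom_mult V_def[symmetric])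
  next
    show "L \<one>\<^bsub>A\<^esub> = \<one>\<^bsub>A\<^esub>" using L[of 1] h.hom_one by simp
  qed
  moreover have "\<exists>t\<in>carrier A. L r = r [^]\<^bsub>A\<^esub> p \<oplus>\<^bsub>A\<^esub> (([p] \<cdot>\<^bsub>A\<^esub> \<one>\<^bsub>A\<^esub>) \<otimes>\<^bsub>A\<^esub> t)"
    if r: "r \<in> carrier A" for r
  proof -
    obtain f where f: "f \<in> polys_in V" "r = \<pi> f" using r unfolding carr by blast
    from f(1) have "of_nat p dvd poly_val y f - f ^ p"
    proof (induction rule: polys_in_induct)
      case (of_int c)
      have "int p dvd c - c ^ p"
        using int_power_prime[OF p, of c] by (metis minus_diff_eq dvd_minus_iff)
      then have "(of_nat p :: zpoly) dvd of_int (c - c ^ p)" by (rule of_nat_dvd_of_int)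
      then show ?case by (simp add: poly_val.hom_of_int)
    next
      case (var v)
      then show ?case using frob[of v] by (simp add: V_def)
    next
      case (add f g)
      obtain z where z: "(f + g) ^ p = f ^ p + g ^ p + of_nat p * z" using add_power_prime[OF p] by blast
      have "of_nat p dvd (poly_val y f - f ^ p) + (poly_val y g - g ^ p) + of_nat p * (- z)"
        by (intro dvd_add add.IH dvd_triv_left)
      then show ?case unfolding z poly_val.hom_add by (simp add: algebra_simps)
    next
      case (mult f g)
      have "of_nat p dvd (poly_val y f - f ^ p) * poly_val y g + f ^ p * (poly_val y g - g ^ p)"
        by (intro dvd_add dvd_mult2[OF mult.IH(1)] dvd_mult[OF mult.IH(2)])
      then show ?case by (simp add: poly_val.hom_mult power_mult_distrib algebra_simps)
    qed
    then obtain t where "poly_val y f = f ^ p + of_nat p * t" by (metis dvdE diff_add_cancel add.commute)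
    \<comment> \<open>\<open>t\<close> may involve foreign variables; restricting moves it into the
      carrier and leaves the other terms alone.\<close>
    then have "restrict_vars V (poly_val y f) = restrict_vars V (f ^ p + of_nat p * t)" by simp
    then have t: "poly_val y f = f ^ p + of_nat p * restrict_vars V t"
      using f y_in by (simp add: restrict_vars.hom_add restrict_vars.hom_mult restrict_vars.hom_power
        restrict_vars.hom_of_nat restrict_vars_id)
    show ?thesis
    proof
      show "\<pi> (restrict_vars V t) \<in> carrier A" unfolding carr by simp
      show "L r = r [^]\<^bsub>A\<^esub> p \<oplus>\<^bsub>A\<^esub> (([p] \<cdot>\<^bsub>A\<^esub> \<one>\<^bsub>A\<^esub>) \<otimes>\<^bsub>A\<^esub> \<pi> (restrict_vars V t))"
        using proj_frobenius_form[of f n "restrict_vars V t" "p\<^sup>2" p] f L t unfolding A_def \<pi>_def V_def by simp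
    qed
  qed
  ultimately show ?thesis unfolding lifts_frobenius_def A_def by blast
qed

lemma lifts_frobenius_3:
  assumes p: "prime p" "odd p"
  shows "lifts_frobenius (mod_nat (R_ring 3) (p\<^sup>2)) p"
proof -
  \<comment> \<open>\<open>c\<close> is the inverse of 2 modulo \<open>p\<^sup>2\<close>, so
    \<open>d i\<close> below plays the part of half of \<open>Xvar (i, i)\<close>.\<close>
  obtain c where c: "p\<^sup>2 + 1 = 2 * c" using p(2) by (metis evenE even_plus_one_iff even_power)
  define C :: zpoly where "C = of_nat c"
  have C: "2 * C = 1 + of_nat (p\<^sup>2)"
    unfolding C_def using arg_cong[OF c, of "of_nat :: nat \<Rightarrow> zpoly"] by (simp add: add.commute)
  have C_in: "C \<in> polys_in V" for V unfolding C_def by simp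
  define d where "d i = C * Xvar (i, i)" for i
  define y where "y v = (if fst v = snd v then 2 * d (fst v) ^ p
    else dickson p (Xvar v) (d (fst v) * d (snd v)))" for v
  let ?X = Xvar
  define P where "P = half_det (d 0) (d 1) (d 2) (?X (0,1)) (?X (0,2)) (?X (1,2))"
  obtain k where k: "p = Suc k" using p(1) by (metis not0_implies_Suc not_prime_0)
  have "P dvd half_det (d 0 ^ p) (d 1 ^ p) (d 2 ^ p) (dickson p (?X (0,1)) (d 0 * d 1))
      (dickson p (?X (0,2)) (d 0 * d 2)) (dickson p (?X (1,2)) (d 1 * d 2))" (is "_ dvd ?Q")
  proof -
    \<comment> \<open>Specialises the generic divisibility by sending the diagonal indeterminates to
      \<open>d i\<close>.\<close>
    define \<sigma> where "\<sigma> v = (if fst v = snd v then d (fst v) else ?X v)" for v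
    from half_det_Xvar_dvd[of k] have "poly_val \<sigma> (half_det (?X (0,0)) (?X (1,1)) (?X (2,2)) (?X (0,1)) (?X (0,2)) (?X (1,2)))
      dvd poly_val \<sigma> (half_det (?X (0,0) ^ p) (?X (1,1) ^ p) (?X (2,2) ^ p) (dickson p (?X (0,1)) (?X (0,0) * ?X (1,1)))
      (dickson p (?X (0,2)) (?X (0,0) * ?X (2,2))) (dickson p (?X (1,2)) (?X (1,1) * ?X (2,2))))"
      unfolding k by (rule poly_val.hom_dvd)
    then show ?thesis
      by (simp add: poly_val.hom_half_det poly_val.hom_dickson poly_val.hom_mult poly_val.hom_power \<sigma>_def P_def)
  qed
  then obtain G where G: "?Q = P * G" ..
  have detX: "det (symX 3) = ?X (0,0) * ?X (1,1) * ?X (2,2) + 2 * ?X (0,1) * ?X (0,2) * ?X (1,2)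
    - ?X (0,0) * ?X (1,2) ^ 2 - ?X (1,1) * ?X (0,2) ^ 2 - ?X (2,2) * ?X (0,1) ^ 2"
    unfolding symX_def det_symmetric_3 ..
  define N :: zpoly where "N = of_nat (p\<^sup>2)"
  \<comment> \<open>\<open>t\<close> collects the error of \<open>2 * C = 1 + N\<close>: the product
    of the diagonal entries carries \<open>(1 + N)^3\<close>, the terms with a single diagonal entry
    carry \<open>1 + N\<close>.\<close>
  define t where "t = ?X (0,0) * ?X (1,1) * ?X (2,2) * (3 + 3*N + N^2)
    - ?X (0,0) * ?X (1,2) ^ 2 - ?X (1,1) * ?X (0,2) ^ 2 - ?X (2,2) * ?X (0,1) ^ 2"
  have "2 * P = (2*C) * (2*C) * (2*C) * (?X (0,0) * ?X (1,1) * ?X (2,2)) + 2 * ?X (0,1) * ?X (0,2) * ?X (1,2)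
    - (2*C) * (?X (0,0) * ?X (1,2) ^ 2 + ?X (1,1) * ?X (0,2) ^ 2 + ?X (2,2) * ?X (0,1) ^ 2)"
    unfolding P_def half_det_def d_def by (simp add: algebra_simps)
  also have "\<dots> = det (symX 3) + N * t"
    unfolding C detX t_def N_def[symmetric] by (simp add: algebra_simps power2_eq_square)
  finally have twoP: "2 * P = det (symX 3) + N * t" .
  have ys: "y (0,0) = 2 * d 0 ^ p" "y (1,1) = 2 * d 1 ^ p" "y (2,2) = 2 * d 2 ^ p"
    "y (0,1) = dickson p (?X (0,1)) (d 0 * d 1)" "y (0,2) = dickson p (?X (0,2)) (d 0 * d 2)"
    "y (1,2) = dickson p (?X (1,2)) (d 1 * d 2)"
    by (simp_all add: y_def)
  have "poly_val y (det (symX 3)) = 2 * ?Q"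
    unfolding poly_val_det_symX det_symmetric_3 ys half_det_def by (simp add: algebra_simps)
  also have "\<dots> = (2 * P) * G" unfolding G by simp
  also have "\<dots> = G * det (symX 3) + of_nat (p\<^sup>2) * (t * G)"
    unfolding twoP N_def by (simp add: algebra_simps)
  finally have det: "poly_val y (det (symX 3)) = G * det (symX 3) + of_nat (p\<^sup>2) * (t * G)" .
  show ?thesis
  proof (rule lifts_frobeniusI[OF p(1) _ _ det])
    fix v assume v: "v \<in> sym_vars 3"
    then have "(fst v, fst v) \<in> sym_vars 3" "(snd v, snd v) \<in> sym_vars 3" by (auto simp: sym_vars_def)
    then have "d (fst v) \<in> polys_in (sym_vars 3)" "d (snd v) \<in> polys_in (sym_vars 3)"
      by (simp_all add: d_def polys_in_mult C_in)
    moreover have "2 \<in> polys_in (sym_vars 3)" using polys_in_of_int[of 2] by simp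
    ultimately show "y v \<in> polys_in (sym_vars 3)"
      using v by (simp add: y_def polys_in_mult polys_in_power dickson_in_polys_in)
    show "of_nat p dvd y v - Xvar v ^ p"
    proof (cases "fst v = snd v")
      case True
      have "(of_nat p :: zpoly) dvd of_int (int c ^ p - int c)"
        using int_power_prime[OF p(1)] by (rule of_nat_dvd_of_int)
      then have "of_nat p dvd C ^ p - C" by (simp add: C_def)
      \<comment> \<open>Because \<open>2 * C = 1 + p\<^sup>2\<close>, adding \<open>p * p\<close>
        turns \<open>2 * (C ^ p - C)\<close> into \<open>2 * C ^ p - 1\<close>.\<close>
      then have "of_nat p dvd 2 * (C ^ p - C) + of_nat p * of_nat p"
        by (intro dvd_add dvd_mult dvd_triv_left)
      also have "2 * (C ^ p - C) + of_nat p * of_nat p = 2 * C ^ p - 1"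
        using C by (simp add: algebra_simps power2_eq_square)
      finally have "of_nat p dvd (2 * C ^ p - 1) * Xvar v ^ p" by (rule dvd_mult2)
      moreover have "v = (fst v, fst v)" using True by (simp add: prod_eq_iff)
      ultimately show ?thesis
        using True by (simp add: y_def d_def power_mult_distrib algebra_simps)
    next
      case False
      then show ?thesis
        using dickson_prime[OF p, of "Xvar v" "d (fst v) * d (snd v)"] by (auto simp: y_def)
    qed
  qed
qed

theorem theorem8p5:
  shows "(\<forall>p::nat. prime p \<and> odd p \<longrightarrow> lifts_frobenius (mod_nat (R_ring 3) (p^2)) p)
       \<and> (\<forall>n::nat. n \<ge> 3 \<longrightarrow> \<not> lifts_frobenius (mod_nat (R_ring n) (2^2)) 2)
       \<and> (\<forall>n::nat. \<forall>p::nat. n \<ge> 4 \<and> prime p \<and> odd p \<longrightarrow>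
              \<not> lifts_frobenius (mod_nat (R_ring n) (p^2)) p)"
  using lifts_frobenius_3 not_lifts_frobenius_2 not_lifts_frobenius_odd by blast


end
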